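(* Every non-trivial solvable group $G$ (not necessarily finitely generated) has uniform twin-width $\mathrm{utww}(G)=2$.
   Context: For totally ordered sets $X,Y$, an $X\times Y$ matrix is a map $M:X\times Y\to\{0,1\}$. If $M$ is finite, a division of $M$ is a pair $(\mathcal X,\mathcal Y)$ of partitions of $X$ and $Y$ into intervals; the quotient $M/(\mathcal X,\mathcal Y)$ is the $\mathcal X\times\mathcal Y$ matrix with entry $1$ at $(X_i,Y_j)$ iff $M$ has a $1$-entry in $X_i\times Y_j$. A division sequence of $M$ is a sequence of divisions starting with the division into singletons, ending with $(\{X\},\{Y\})$, each obtained from the previous one by merging two (consecutive) parts of $\mathcal X$ or two of $\mathcal Y$. Its width is the maximum number of $1$-entries in a row or column of a quotient matrix along the sequence. The strict twin-width $\mathrm{stww}(M)$ is the minimum width of a division sequence; for infinite $M$ it is the supremum over finite submatrices. For a group $G$, a total order $<$ on $G$ and $g\in G$, let $M_g^<$ be the $(G,<)\times(G,<)$ matrix with $M_g^<(x,y)=1$ iff $xg=y$. The uniform twin-width is $\mathrm{utww}(G)=\min_{<}\ \sup_{g\in G}\mathrm{stww}(M_g^<)\in\mathbb N\cup\{\infty\}$, the minimum being over all total orders $<$ on $G$. *)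

theory Defs
  imports
    "HOL-Algebra.Solvable_Groups"
    "HOL-Algebra.Elementary_Groups"
    "HOL-Library.Disjoint_Sets"
    "HOL-Library.Extended_Nat"
begin

text \<open>
  A 0/1 matrix with ordered row set \<open>(X, r)\<close> and ordered column set \<open>(Y, s)\<close> is a predicate
  \<open>M :: 'a \<Rightarrow> 'b \<Rightarrow> bool\<close>, of which only the values on \<open>X \<times> Y\<close> matter; the relations \<open>r\<close> and \<open>s\<close>
  are reflexive linear orders, and only their restrictions to \<open>X\<close> and \<open>Y\<close> matter. Hence the
  submatrix on \<open>X' \<subseteq> X\<close>, \<open>Y' \<subseteq> Y\<close> is given by the same \<open>M\<close>, \<open>r\<close>, \<open>s\<close>.
\<close>

definition interval_in :: "'a rel \<Rightarrow> 'a set \<Rightarrow> 'a set \<Rightarrow> bool" where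
  "interval_in r X I \<longleftrightarrow>
     I \<subseteq> X \<and> (\<forall>x\<in>I. \<forall>z\<in>I. \<forall>y\<in>X. (x, y) \<in> r \<longrightarrow> (y, z) \<in> r \<longrightarrow> y \<in> I)"

definition interval_partition :: "'a rel \<Rightarrow> 'a set \<Rightarrow> 'a set set \<Rightarrow> bool" where
  "interval_partition r X P \<longleftrightarrow> partition_on X P \<and> (\<forall>I\<in>P. interval_in r X I)"

definition is_division ::
  "'a rel \<Rightarrow> 'a set \<Rightarrow> 'b rel \<Rightarrow> 'b set \<Rightarrow> 'a set set \<times> 'b set set \<Rightarrow> bool" where
  "is_division r X s Y D \<longleftrightarrow>
     interval_partition r X (fst D) \<and> interval_partition s Y (snd D)"

definition quotient_matrix :: "('a \<Rightarrow> 'b \<Rightarrow> bool) \<Rightarrow> 'a set \<Rightarrow> 'b set \<Rightarrow> bool" where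
  "quotient_matrix M I J \<longleftrightarrow> (\<exists>x\<in>I. \<exists>y\<in>J. M x y)"

definition singletons :: "'a set \<Rightarrow> 'a set set" where
  "singletons X = (\<lambda>x. {x}) ` X"

definition merges :: "'a set set \<Rightarrow> 'a set set \<Rightarrow> bool" where
  "merges P P' \<longleftrightarrow> (\<exists>A\<in>P. \<exists>B\<in>P. A \<noteq> B \<and> P' = insert (A \<union> B) (P - {A, B}))"

text \<open>
  Consecutiveness of the two merged parts is not stated separately: all members of the sequence
  are required to be divisions, so the union of the merged parts must again be an interval.
\<close>

definition division_sequence ::
  "'a rel \<Rightarrow> 'a set \<Rightarrow> 'b rel \<Rightarrow> 'b set \<Rightarrow> ('a set set \<times> 'b set set) list \<Rightarrow> bool" where
  "division_sequence r X s Y Ds \<longleftrightarrow>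
     Ds \<noteq> [] \<and>
     (\<forall>D\<in>set Ds. is_division r X s Y D) \<and>
     hd Ds = (singletons X, singletons Y) \<and>
     last Ds = ({X}, {Y}) \<and>
     (\<forall>i. Suc i < length Ds \<longrightarrow>
        merges (fst (Ds ! i)) (fst (Ds ! Suc i)) \<and> snd (Ds ! Suc i) = snd (Ds ! i) \<or>
        fst (Ds ! Suc i) = fst (Ds ! i) \<and> merges (snd (Ds ! i)) (snd (Ds ! Suc i)))"

definition max_ones :: "('a \<Rightarrow> 'b \<Rightarrow> bool) \<Rightarrow> 'a set \<Rightarrow> 'b set \<Rightarrow> nat" where
  "max_ones M X Y =
     Max ((\<lambda>x. card {y\<in>Y. M x y}) ` X \<union> (\<lambda>y. card {x\<in>X. M x y}) ` Y)"

definition sequence_width ::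
  "('a \<Rightarrow> 'b \<Rightarrow> bool) \<Rightarrow> ('a set set \<times> 'b set set) list \<Rightarrow> nat" where
  "sequence_width M Ds =
     Max ((\<lambda>D. max_ones (quotient_matrix M) (fst D) (snd D)) ` set Ds)"

text \<open>
  On \<^typ>\<open>enat\<close>, the infimum of a nonempty set is its minimum. In the infinite case, only
  submatrices with nonempty row and column sets are considered, since an empty matrix has no
  division sequence in the above sense (\<open>{{}}\<close> is not a partition of the empty set).
\<close>

definition stww_finite ::
  "'a rel \<Rightarrow> 'a set \<Rightarrow> 'b rel \<Rightarrow> 'b set \<Rightarrow> ('a \<Rightarrow> 'b \<Rightarrow> bool) \<Rightarrow> enat" where
  "stww_finite r X s Y M = (INF Ds\<in>{Ds. division_sequence r X s Y Ds}. enat (sequence_width M Ds))"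

definition stww ::
  "'a rel \<Rightarrow> 'a set \<Rightarrow> 'b rel \<Rightarrow> 'b set \<Rightarrow> ('a \<Rightarrow> 'b \<Rightarrow> bool) \<Rightarrow> enat" where
  "stww r X s Y M =
     (if finite X \<and> finite Y then stww_finite r X s Y M
      else (SUP (X', Y')\<in>{(X', Y'). X' \<subseteq> X \<and> finite X' \<and> X' \<noteq> {} \<and>
                                     Y' \<subseteq> Y \<and> finite Y' \<and> Y' \<noteq> {}}.
              stww_finite r X' s Y' M))"

definition translation_matrix :: "('a, 'b) monoid_scheme \<Rightarrow> 'a \<Rightarrow> 'a \<Rightarrow> 'a \<Rightarrow> bool" where
  "translation_matrix G g x y \<longleftrightarrow> x \<otimes>\<^bsub>G\<^esub> g = y"

definition utww :: "('a, 'b) monoid_scheme \<Rightarrow> enat" where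
  "utww G =
     (INF r\<in>{r. linear_order_on (carrier G) r}.
        SUP g\<in>carrier G. stww r (carrier G) r (carrier G) (translation_matrix G g))"

end

theory Submission
  imports Defs "HOL-Computational_Algebra.Group_Closure"
begin

text \<open>
  A finite partial permutation is separable if every set of at least two of its entries splits, along
  the rows, into a lower and an upper part whose columns are again separated, in either order. Such a
  set contains two entries that are consecutive in both directions, so merging their two rows and then
  their two columns leaves a separable partial permutation and never creates more than two ones
  in a line: the strict twin-width is at most 2.

  Being separable for all right translations is a condition on finite subsets, hence it survives unions
  of chains of ordered subgroups. If a subgroup \<open>L\<close> carries such an order and \<open>a\<close>
  normalizes it, order \<open>L\<langle>a\<rangle>\<close> lexicographically, first by the coset \<open>L a\<^sup>k\<close>, with \<open>k\<close> ranging over the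
  integers or over \<open>{0..<n}\<close>, and then within the coset by the order of \<open>L\<close>: a right translation acts on the
  cosets by a shift or a cyclic shift, and from coset to coset by right translations of \<open>L\<close>.
  By Zorn's lemma the order extends along each abelian quotient of a solvable series.
\<close>

section \<open>Separable partial permutations\<close>

abbreviation between :: "nat \<Rightarrow> nat \<Rightarrow> nat \<Rightarrow> bool" where
  "between a b c \<equiv> a \<le> b \<and> b \<le> c \<or> c \<le> b \<and> b \<le> a"

text \<open>Induction on \<open>T\<close>: a pair that is adjacent within one of the two parts stays
  adjacent in \<open>T\<close>, since the other part lies entirely on one side of it, both for
  \<open>p\<close> and for \<open>q\<close>. If both parts are singletons, they form the
  pair.\<close>

lemma separable_adjacent_pair:
  fixes p q :: "'c \<Rightarrow> nat"
  assumes "finite T"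
    and "\<And>T'. T' \<subseteq> T \<Longrightarrow> \<exists>x\<in>T'. \<exists>y\<in>T'. x \<noteq> y \<Longrightarrow>
      \<exists>A B. A \<noteq> {} \<and> B \<noteq> {} \<and> A \<union> B = T' \<and> (\<forall>a\<in>A. \<forall>b\<in>B. p a < p b) \<and>
        ((\<forall>a\<in>A. \<forall>b\<in>B. q a < q b) \<or> (\<forall>a\<in>A. \<forall>b\<in>B. q b < q a))"
    and "\<exists>x\<in>T. \<exists>y\<in>T. x \<noteq> y"
  shows "\<exists>x\<in>T. \<exists>y\<in>T. x \<noteq> y \<and>
    (\<forall>t\<in>T. between (p x) (p t) (p y) \<or> between (q x) (q t) (q y) \<longrightarrow> t = x \<or> t = y)"
  using assms
proof (induction T rule: finite_psubset_induct)
  case (psubset T)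
  obtain A B where AB: "A \<noteq> {}" "B \<noteq> {}" "A \<union> B = T" "\<And>a b. a \<in> A \<Longrightarrow> b \<in> B \<Longrightarrow> p a < p b"
    "(\<forall>a\<in>A. \<forall>b\<in>B. q a < q b) \<or> (\<forall>a\<in>A. \<forall>b\<in>B. q b < q a)"
    using psubset.prems(1)[OF subset_refl psubset.prems(2)] by metis
  have disj: "A \<inter> B = {}"
    using AB(4) by fastforce
  have sub: "\<exists>x\<in>C. \<exists>y\<in>C. x \<noteq> y \<and>
      (\<forall>t\<in>C. between (p x) (p t) (p y) \<or> between (q x) (q t) (q y) \<longrightarrow> t = x \<or> t = y)"
    if "C \<subset> T" "\<exists>x\<in>C. \<exists>y\<in>C. x \<noteq> y" for C
  proof (rule psubset.IH[OF that(1) _ that(2)])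
    show "\<exists>A B. A \<noteq> {} \<and> B \<noteq> {} \<and> A \<union> B = T' \<and> (\<forall>a\<in>A. \<forall>b\<in>B. p a < p b) \<and>
        ((\<forall>a\<in>A. \<forall>b\<in>B. q a < q b) \<or> (\<forall>a\<in>A. \<forall>b\<in>B. q b < q a))"
      if "T' \<subseteq> C" "\<exists>x\<in>T'. \<exists>y\<in>T'. x \<noteq> y" for T'
      by (rule psubset.prems(1)[OF _ that(2)]) (use that(1) \<open>C \<subset> T\<close> in auto)
  qed
  show ?case
  proof (cases "\<exists>x\<in>A. \<exists>y\<in>A. x \<noteq> y")
    case True
    then obtain x y where xy: "x \<in> A" "y \<in> A" "x \<noteq> y" and
      "\<And>t. t \<in> A \<Longrightarrow> between (p x) (p t) (p y) \<or> between (q x) (q t) (q y) \<Longrightarrow> t = x \<or> t = y"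
      using sub[of A] AB(1-3) disj by blast
    moreover have "\<not> between (p x) (p t) (p y)" "\<not> between (q x) (q t) (q y)" if "t \<in> B" for t
      using AB(4,5) xy that by (meson leD)+
    ultimately show ?thesis
      using AB(3) by blast
  next
    case A: False
    show ?thesis
    proof (cases "\<exists>x\<in>B. \<exists>y\<in>B. x \<noteq> y")
      case True
      then obtain x y where xy: "x \<in> B" "y \<in> B" "x \<noteq> y" and
        "\<And>t. t \<in> B \<Longrightarrow> between (p x) (p t) (p y) \<or> between (q x) (q t) (q y) \<Longrightarrow> t = x \<or> t = y"
        using sub[of B] AB(1-3) disj by blast
      moreover have "\<not> between (p x) (p t) (p y)" "\<not> between (q x) (q t) (q y)" if "t \<in> A" for t
        using AB(4,5) xy that by (meson leD)+
      ultimately show ?thesis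
        using AB(3) by blast
    next
      case False
      with A AB(1-3) psubset.prems(2) show ?thesis
        by (metis UnE)
    qed
  qed
qed

section \<open>Interval partitions of a finite linear order\<close>

text \<open>The rank counts the elements of \<open>X\<close> up to a given one. With natural numbers
  in place of the order, arguments about betweenness become linear arithmetic.\<close>

lemma finite_linear_order_rank:
  assumes "linear_order_on C r" "finite X" "X \<subseteq> C"
  obtains u :: "'a \<Rightarrow> nat" where "inj_on u X"
    and "\<And>x y. x \<in> X \<Longrightarrow> y \<in> X \<Longrightarrow> (x, y) \<in> r \<longleftrightarrow> u x \<le> u y"
proof
  define u where "u x = card {w \<in> X. (w, x) \<in> r}" for x
  have refl: "(x, x) \<in> r" if "x \<in> X" for x
    using assms(1,3) that by (auto simp: order_on_defs refl_on_def)
  have trans: "(x, z) \<in> r" if "(x, y) \<in> r" "(y, z) \<in> r" for x y z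
    using assms(1) that by (auto simp: order_on_defs dest: transD)
  have anti: "x = y" if "(x, y) \<in> r" "(y, x) \<in> r" for x y
    using assms(1) that by (auto simp: order_on_defs dest: antisymD)
  have total: "(x, y) \<in> r \<or> (y, x) \<in> r" if "x \<in> X" "y \<in> X" for x y
    using assms(1,3) that refl[of x] unfolding order_on_defs total_on_def by (metis subsetD)
  have mono: "u x \<le> u y" if "(x, y) \<in> r" for x y
    unfolding u_def using assms(2) trans that by (intro card_mono) auto
  have strict: "u x < u y" if "x \<in> X" "y \<in> X" "(x, y) \<in> r" "x \<noteq> y" for x y
  proof -
    have "(y, x) \<notin> r"
      using anti that by blast
    then have "{w \<in> X. (w, x) \<in> r} \<subset> {w \<in> X. (w, y) \<in> r}"
      using trans[OF _ that(3)] refl[OF that(2)] that(2) by auto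
    then show ?thesis
      unfolding u_def using assms(2) by (intro psubset_card_mono) auto
  qed
  show "(x, y) \<in> r \<longleftrightarrow> u x \<le> u y" if "x \<in> X" "y \<in> X" for x y
    using mono strict total that by (metis leD)
  show "inj_on u X"
    using strict total by (metis inj_onI nat_less_le)
qed

locale ranked_set =
  fixes r :: "'a rel" and X :: "'a set" and u :: "'a \<Rightarrow> nat"
  assumes finite_carrier: "finite X" and nonempty: "X \<noteq> {}"
    and inj_rank: "inj_on u X"
    and rank: "\<And>x y. x \<in> X \<Longrightarrow> y \<in> X \<Longrightarrow> (x, y) \<in> r \<longleftrightarrow> u x \<le> u y"
begin

lemma interval_in_between:
  "interval_in r X I \<longleftrightarrow>
    I \<subseteq> X \<and> (\<forall>x\<in>I. \<forall>z\<in>I. \<forall>y\<in>X. between (u x) (u y) (u z) \<longrightarrow> y \<in> I)"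
proof (cases "I \<subseteq> X")
  case True
  then have "(x, y) \<in> r \<longleftrightarrow> u x \<le> u y" "(y, x) \<in> r \<longleftrightarrow> u y \<le> u x" if "x \<in> I" "y \<in> X" for x y
    using rank that by auto
  then show ?thesis
    unfolding interval_in_def by (simp cong: ball_cong) blast
qed (simp add: interval_in_def)

lemma interval_partitionD:
  assumes "interval_partition r X P"
  shows "\<Union>P = X" "{} \<notin> P" "finite P"
    and "\<And>A B x. A \<in> P \<Longrightarrow> B \<in> P \<Longrightarrow> x \<in> A \<Longrightarrow> x \<in> B \<Longrightarrow> A = B"
    and "\<And>A x y z. A \<in> P \<Longrightarrow> x \<in> A \<Longrightarrow> z \<in> A \<Longrightarrow> y \<in> X \<Longrightarrow> between (u x) (u y) (u z) \<Longrightarrow> y \<in> A"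
proof -
  have P: "partition_on X P" "\<And>A. A \<in> P \<Longrightarrow> interval_in r X A"
    using assms unfolding interval_partition_def by auto
  show "\<Union>P = X" "{} \<notin> P"
    using P(1) by (auto simp: partition_on_def)
  show "finite P"
    using P(1) finite_carrier by (rule finite_elements[rotated])
  show "A = B" if "A \<in> P" "B \<in> P" "x \<in> A" "x \<in> B" for A B x
    using partition_onD2[OF P(1)] that by (auto dest: disjointD)
  show "y \<in> A" if "A \<in> P" "x \<in> A" "z \<in> A" "y \<in> X" "between (u x) (u y) (u z)" for A x y z
    using P(2)[OF that(1)] that(2-) unfolding interval_in_between by blast
qed

text \<open>Checking the gap between one element of each part suffices: a point outside both
  intervals has all of \<open>A\<close> on one side and all of \<open>B\<close> on one side, so if
  it separates some \<open>x\<close> in \<open>A\<close> from some \<open>z\<close> in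
  \<open>B\<close>, it also separates \<open>a\<close> from \<open>b\<close>.\<close>

lemma interval_partition_merge:
  assumes P: "interval_partition r X P" and "A \<in> P" "B \<in> P" "A \<noteq> B" "a \<in> A" "b \<in> B"
    and gap: "\<And>w. w \<in> X \<Longrightarrow> between (u a) (u w) (u b) \<Longrightarrow> w \<in> A \<union> B"
  shows "interval_partition r X (insert (A \<union> B) (P - {A, B}))"
proof -
  note D = interval_partitionD[OF P]
  have X: "x \<in> X" if "x \<in> A \<union> B" for x
    using D(1) assms(2,3) that by blast
  have cross: "y \<in> A \<union> B" if "x \<in> A" "z \<in> B" "y \<in> X" "between (u x) (u y) (u z)" for x y z
  proof (rule ccontr)
    assume y: "y \<notin> A \<union> B"
    have "\<not> between (u a) (u y) (u b)" "\<not> between (u a) (u y) (u x)" "\<not> between (u b) (u y) (u z)"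
      using y gap D(5) assms that by blast+
    then show False
      using that(4) by linarith
  qed
  have "interval_in r X (A \<union> B)"
    unfolding interval_in_between
  proof (intro conjI ballI impI)
    fix x z y assume h: "x \<in> A \<union> B" "z \<in> A \<union> B" "y \<in> X" "between (u x) (u y) (u z)"
    then have "between (u z) (u y) (u x)"
      by blast
    with h show "y \<in> A \<union> B"
      using cross D(5) assms(2,3) by (metis UnE UnI1 UnI2)
  qed (use X in blast)
  moreover have "partition_on X (insert (A \<union> B) (P - {A, B}))"
  proof (rule partition_onI)
    show "\<Union>(insert (A \<union> B) (P - {A, B})) = X"
      using D(1) assms(2,3) by blast
    show "{} \<notin> insert (A \<union> B) (P - {A, B})"
      using D(2) assms(5) by blast
    show "disjnt p q" if "p \<in> insert (A \<union> B) (P - {A, B})" "q \<in> insert (A \<union> B) (P - {A, B})" "p \<noteq> q" for p q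
      using that D(4) assms(2,3) unfolding disjnt_iff by (smt (verit) DiffE Un_iff insert_iff)
  qed
  ultimately show ?thesis
    using P unfolding interval_partition_def by blast
qed

text \<open>Among all pairs of a point in \<open>A\<close> and a point outside \<open>A\<close>, one
  with the fewest points in between has none strictly between; the part of its outer point is a
  neighbour of \<open>A\<close>.\<close>

lemma interval_partition_neighbour:
  assumes P: "interval_partition r X P" and A: "A \<in> P" and "P \<noteq> {A}"
  obtains B where "B \<in> P" "B \<noteq> A" "interval_partition r X (insert (A \<union> B) (P - {A, B}))"
proof -
  note D = interval_partitionD[OF P]
  define N where "N ab = card {w \<in> X. between (u (fst ab)) (u w) (u (snd ab))}" for ab
  obtain C where C: "C \<in> P" "C \<noteq> A"
    using assms(2,3) by auto
  then obtain c where "c \<in> C"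
    using D(2) by (metis ex_in_conv)
  then have "c \<in> X" "c \<notin> A"
    using C D(1) D(4)[OF C(1) A] by auto
  moreover obtain a0 where "a0 \<in> A"
    using A D(2) by fastforce
  ultimately have "(a0, c) \<in> A \<times> (X - A)"
    by blast
  then obtain ab where "ab \<in> A \<times> (X - A)" and least: "\<And>z. z \<in> A \<times> (X - A) \<Longrightarrow> N ab \<le> N z"
    using ex_has_least_nat[of "\<lambda>z. z \<in> A \<times> (X - A)" _ N] by blast
  then obtain a b where ab: "ab = (a, b)" "a \<in> A" "b \<in> X" "b \<notin> A"
    by blast
  have aX: "a \<in> X"
    using ab(2) A D(1) by blast
  have gap: "w = a \<or> w = b" if w: "w \<in> X" "between (u a) (u w) (u b)" for w
  proof (rule ccontr)
    assume "\<not> ?thesis"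
    then have ne: "u w \<noteq> u a" "u w \<noteq> u b"
      using inj_rank aX ab(3) w(1) by (auto dest: inj_onD)
    \<comment> \<open>A point \<open>w\<close> strictly between replaces \<open>a\<close> if it lies
      in \<open>A\<close> and \<open>b\<close> otherwise. The smaller range loses the replaced
      endpoint, which is the \<open>z\<close> here, contradicting the minimality of
      \<open>N ab\<close>.\<close>
    have less: "card {x \<in> X. between (u c) (u x) (u d)} < N ab"
      if "z \<in> X" "between (u a) (u z) (u b)" "\<not> between (u c) (u z) (u d)"
        "between (u a) (u c) (u b)" "between (u a) (u d) (u b)" for c d z
      unfolding N_def ab(1)
    proof (rule psubset_card_mono)
      have "{x \<in> X. between (u c) (u x) (u d)} \<subseteq> {x \<in> X. between (u a) (u x) (u b)}"
        using that(4,5) by auto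
      then show "{x \<in> X. between (u c) (u x) (u d)}
          \<subset> {x \<in> X. between (u (fst (a, b))) (u x) (u (snd (a, b)))}"
        using that(1-3) by auto
    qed (use finite_carrier in simp)
    show False
    proof (cases "w \<in> A")
      case True
      have "N (w, b) < N ab"
        unfolding N_def[of "(w, b)"] fst_conv snd_conv
        by (rule less[of a]) (use aX ne w in auto)
      moreover have "N ab \<le> N (w, b)"
        using least True ab by blast
      ultimately show False by simp
    next
      case False
      have "N (a, w) < N ab"
        unfolding N_def[of "(a, w)"] fst_conv snd_conv
        by (rule less[of b]) (use ab ne w in auto)
      moreover have "N ab \<le> N (a, w)"
        using least False w ab by blast
      ultimately show False by simp
    qed
  qed
  obtain B where B: "B \<in> P" "b \<in> B"
    using ab(3) D(1) by blast
  then have "B \<noteq> A"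
    using ab(4) by blast
  moreover have "interval_partition r X (insert (A \<union> B) (P - {A, B}))"
    by (rule interval_partition_merge[OF P A B(1) _ ab(2) B(2)]) (use gap ab B \<open>B \<noteq> A\<close> in auto)
  ultimately show ?thesis
    using that B by blast
qed

lemma interval_partition_singletons: "interval_partition r X (singletons X)"
proof -
  have "interval_in r X {x}" if "x \<in> X" for x
    unfolding interval_in_between using that inj_rank by (auto dest: inj_onD)
  then show ?thesis
    unfolding interval_partition_def singletons_def using partition_on_singletons[of X] by simp
qed

lemma interval_partition_eq_singleton:
  assumes "interval_partition r X {A}"
  shows "A = X"
  using interval_partitionD(1)[OF assms] by simp

end

section \<open>Division sequences of width two\<close>

text \<open>\<open>T\<close> is a set of representatives of the ones of the quotient. In the course
  of a division sequence \<open>T\<close> shrinks, while \<open>M\<close> is kept.\<close>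

definition covers :: "('a \<Rightarrow> 'b \<Rightarrow> bool) \<Rightarrow> ('a \<times> 'b) set \<Rightarrow> 'a set set \<Rightarrow> 'b set set \<Rightarrow> bool" where
  "covers M T P Q \<longleftrightarrow>
     (\<forall>A\<in>P. \<forall>B\<in>Q. quotient_matrix M A B \<longrightarrow> (\<exists>t\<in>T. fst t \<in> A \<and> snd t \<in> B))"

lemma card_met_parts_le:
  assumes "finite T" and "disjoint Q"
    and "\<And>B. B \<in> Q \<Longrightarrow> R B \<Longrightarrow> \<exists>t\<in>T. f t \<in> B"
  shows "card {B \<in> Q. R B} \<le> card T"
proof -
  obtain g where g: "\<And>B. B \<in> Q \<Longrightarrow> R B \<Longrightarrow> g B \<in> T \<and> f (g B) \<in> B"
    using assms(3) by metis
  then have "inj_on g {B \<in> Q. R B}"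
    using assms(2) unfolding inj_on_def disjoint_def by (metis (mono_tags, lifting) disjoint_iff mem_Collect_eq)
  then show ?thesis
    using g assms(1) by (intro card_inj_on_le[of g]) auto
qed

text \<open>Disjoint parts have distinct representatives, so counting the members of
  \<open>T\<close> in a line bounds the number of its ones.\<close>

lemma max_ones_le:
  assumes "finite T" and "covers M T P Q"
    and P: "disjoint P" "finite P" "P \<noteq> {}" and Q: "disjoint Q" "finite Q"
    and "\<And>A. A \<in> P \<Longrightarrow> card {t \<in> T. fst t \<in> A} \<le> k"
    and "\<And>B. B \<in> Q \<Longrightarrow> card {t \<in> T. snd t \<in> B} \<le> k"
  shows "max_ones (quotient_matrix M) P Q \<le> k"
proof -
  have "card {B \<in> Q. quotient_matrix M A B} \<le> k" if "A \<in> P" for A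
  proof -
    have "card {B \<in> Q. quotient_matrix M A B} \<le> card {t \<in> T. fst t \<in> A}"
    proof (rule card_met_parts_le[where f = snd])
      show "\<exists>t\<in>{t \<in> T. fst t \<in> A}. snd t \<in> B" if "B \<in> Q" "quotient_matrix M A B" for B
        using assms(2) \<open>A \<in> P\<close> that unfolding covers_def by blast
    qed (use assms(1) Q(1) in auto)
    also have "\<dots> \<le> k"
      using assms that by blast
    finally show ?thesis .
  qed
  moreover have "card {A \<in> P. quotient_matrix M A B} \<le> k" if "B \<in> Q" for B
  proof -
    have "card {A \<in> P. quotient_matrix M A B} \<le> card {t \<in> T. snd t \<in> B}"
    proof (rule card_met_parts_le[where f = fst])
      show "\<exists>t\<in>{t \<in> T. snd t \<in> B}. fst t \<in> A" if "A \<in> P" "quotient_matrix M A B" for A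
        using assms(2) \<open>B \<in> Q\<close> that unfolding covers_def by blast
    qed (use assms(1) P(1) in auto)
    also have "\<dots> \<le> k"
      using assms that by blast
    finally show ?thesis .
  qed
  ultimately show ?thesis
    unfolding max_ones_def using P Q by (intro Max.boundedI) auto
qed

lemma covers_merge_rows:
  assumes "covers M T P Q" "A \<in> P" "B \<in> P"
  shows "covers M T (insert (A \<union> B) (P - {A, B})) Q"
proof -
  have "\<exists>t\<in>T. fst t \<in> A \<union> B \<and> snd t \<in> C" if "C \<in> Q" "quotient_matrix M (A \<union> B) C" for C
  proof -
    have "quotient_matrix M A C \<or> quotient_matrix M B C"
      using that(2) unfolding quotient_matrix_def by blast
    then show ?thesis
      using assms that(1) unfolding covers_def by blast
  qed
  then show ?thesis
    using assms(1) unfolding covers_def by simp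
qed

lemma covers_merge_columns:
  assumes "covers M T P Q" "A \<in> Q" "B \<in> Q"
  shows "covers M T P (insert (A \<union> B) (Q - {A, B}))"
proof -
  have "\<exists>t\<in>T. fst t \<in> C \<and> snd t \<in> A \<union> B" if "C \<in> P" "quotient_matrix M C (A \<union> B)" for C
  proof -
    have "quotient_matrix M C A \<or> quotient_matrix M C B"
      using that(2) unfolding quotient_matrix_def by blast
    then show ?thesis
      using assms that(1) unfolding covers_def by blast
  qed
  then show ?thesis
    using assms(1) unfolding covers_def by simp
qed

section \<open>Contraction to the trivial division\<close>

text \<open>A final segment of a division sequence, with width bound \<open>k\<close>, starting at
  an arbitrary division \<open>D\<close>. Such segments can be built backwards by induction on the
  number of remaining parts.\<close>

definition contractible ::
  "'a rel \<Rightarrow> 'a set \<Rightarrow> 'b rel \<Rightarrow> 'b set \<Rightarrow> ('a \<Rightarrow> 'b \<Rightarrow> bool) \<Rightarrow> nat \<Rightarrow> 'a set set \<times> 'b set set \<Rightarrow> bool" where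
  "contractible r X s Y M k D \<longleftrightarrow>
     (\<exists>Ds. Ds \<noteq> [] \<and> hd Ds = D \<and> last Ds = ({X}, {Y}) \<and>
       (\<forall>D\<in>set Ds. is_division r X s Y D \<and> max_ones (quotient_matrix M) (fst D) (snd D) \<le> k) \<and>
       (\<forall>i. Suc i < length Ds \<longrightarrow>
          merges (fst (Ds ! i)) (fst (Ds ! Suc i)) \<and> snd (Ds ! Suc i) = snd (Ds ! i) \<or>
          fst (Ds ! Suc i) = fst (Ds ! i) \<and> merges (snd (Ds ! i)) (snd (Ds ! Suc i))))"

lemma contractible_step:
  assumes "contractible r X s Y M k D'"
    and D: "is_division r X s Y D" "max_ones (quotient_matrix M) (fst D) (snd D) \<le> k"
    and step: "merges (fst D) (fst D') \<and> snd D' = snd D \<or> fst D' = fst D \<and> merges (snd D) (snd D')"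
  shows "contractible r X s Y M k D"
proof -
  obtain Ds where Ds: "Ds \<noteq> []" "hd Ds = D'" "last Ds = ({X}, {Y})"
    "\<forall>D\<in>set Ds. is_division r X s Y D \<and> max_ones (quotient_matrix M) (fst D) (snd D) \<le> k"
    "\<And>i. Suc i < length Ds \<Longrightarrow>
      merges (fst (Ds ! i)) (fst (Ds ! Suc i)) \<and> snd (Ds ! Suc i) = snd (Ds ! i) \<or>
      fst (Ds ! Suc i) = fst (Ds ! i) \<and> merges (snd (Ds ! i)) (snd (Ds ! Suc i))"
    using assms(1) unfolding contractible_def by blast
  have "merges (fst ((D # Ds) ! i)) (fst ((D # Ds) ! Suc i)) \<and> snd ((D # Ds) ! Suc i) = snd ((D # Ds) ! i) \<or>
      fst ((D # Ds) ! Suc i) = fst ((D # Ds) ! i) \<and> merges (snd ((D # Ds) ! i)) (snd ((D # Ds) ! Suc i))"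
    if "Suc i < length (D # Ds)" for i
  proof (cases i)
    case 0
    then show ?thesis
      using step Ds(1,2) by (simp add: hd_conv_nth)
  next
    case (Suc j)
    then show ?thesis
      using Ds(5)[of j] that by simp
  qed
  with Ds(1,3,4) D show ?thesis
    unfolding contractible_def by (intro exI[of _ "D # Ds"]) simp
qed

lemma contractible_imp_stww_finite_le:
  assumes "contractible r X s Y M k (singletons X, singletons Y)"
  shows "stww_finite r X s Y M \<le> enat k"
proof -
  obtain Ds where Ds: "division_sequence r X s Y Ds" "Ds \<noteq> []"
    "\<forall>D\<in>set Ds. max_ones (quotient_matrix M) (fst D) (snd D) \<le> k"
    using assms unfolding contractible_def division_sequence_def by blast
  then have "sequence_width M Ds \<le> k"
    unfolding sequence_width_def by (intro Max.boundedI) auto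
  then show ?thesis
    unfolding stww_finite_def using Ds(1) by (intro INF_lower2[of Ds]) auto
qed

lemma card_merge_le:
  assumes "card {t \<in> T. f t \<in> A} \<le> m" "card {t \<in> T. f t \<in> B} \<le> n"
  shows "card {t \<in> T. f t \<in> A \<union> B} \<le> m + n"
proof -
  have "{t \<in> T. f t \<in> A \<union> B} = {t \<in> T. f t \<in> A} \<union> {t \<in> T. f t \<in> B}"
    by blast
  then show ?thesis
    using card_Un_le[of "{t \<in> T. f t \<in> A}" "{t \<in> T. f t \<in> B}"] assms by simp
qed

lemma card_le_1_iff:
  assumes "finite T"
  shows "card {t \<in> T. f t \<in> A} \<le> 1 \<longleftrightarrow> (\<forall>t\<in>T. \<forall>t'\<in>T. f t \<in> A \<longrightarrow> f t' \<in> A \<longrightarrow> t = t')"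
  using assms card_le_Suc0_iff_eq[of "{t \<in> T. f t \<in> A}"] by auto

lemma card_insert_merge_less:
  assumes "finite P" "A \<in> P" "B \<in> P" "A \<noteq> B"
  shows "card (insert (A \<union> B) (P - {A, B})) < card P"
proof -
  have "card (P - {A, B}) = card P - 2" "card P \<ge> 2"
    using assms card_mono[of P "{A, B}"] by (auto simp: card_Diff_subset)
  \<comment> \<open>Only an upper bound: in an arbitrary set of sets, \<open>A \<union> B\<close>
    may already be a member.\<close>
  moreover have "card (insert (A \<union> B) (P - {A, B})) \<le> Suc (card (P - {A, B}))"
    using assms(1) by (simp add: card_insert_if)
  ultimately show ?thesis
    by linarith
qed

text \<open>\<open>adjacent\<close> is the conclusion of \<open>separable_adjacent_pair\<close>,
  required for every set of ones that can arise as a set of representatives. It is the form in which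
  separability enters the contraction.\<close>

locale separable_matrix = rows: ranked_set r X u + columns: ranked_set s Y v
  for r :: "'a rel" and X u and s :: "'b rel" and Y v +
  fixes M :: "'a \<Rightarrow> 'b \<Rightarrow> bool"
  assumes row_unique: "\<And>x y y'. M x y \<Longrightarrow> M x y' \<Longrightarrow> y = y'"
    and column_unique: "\<And>x x' y. x \<in> X \<Longrightarrow> x' \<in> X \<Longrightarrow> M x y \<Longrightarrow> M x' y \<Longrightarrow> x = x'"
    and adjacent: "\<And>T. T \<subseteq> {(x, y) \<in> X \<times> Y. M x y} \<Longrightarrow> \<exists>p\<in>T. \<exists>q\<in>T. p \<noteq> q \<Longrightarrow>
      \<exists>p\<in>T. \<exists>q\<in>T. p \<noteq> q \<and> (\<forall>t\<in>T. between (u (fst p)) (u (fst t)) (u (fst q)) \<or>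
        between (v (snd p)) (v (snd t)) (v (snd q)) \<longrightarrow> t = p \<or> t = q)"
begin

text \<open>The invariant of the contraction: for a division into \<open>P\<close> and
  \<open>Q\<close>, the quotient is again a partial permutation matrix, and \<open>T\<close> selects
  one original entry in each of its ones.\<close>

definition matching :: "('a \<times> 'b) set \<Rightarrow> 'a set set \<Rightarrow> 'b set set \<Rightarrow> bool" where
  "matching T P Q \<longleftrightarrow> T \<subseteq> {(x, y) \<in> X \<times> Y. M x y} \<and> covers M T P Q \<and>
     (\<forall>A\<in>P. card {t \<in> T. fst t \<in> A} \<le> 1) \<and> (\<forall>B\<in>Q. card {t \<in> T. snd t \<in> B} \<le> 1)"

lemma finite_entries: "T \<subseteq> {(x, y) \<in> X \<times> Y. M x y} \<Longrightarrow> finite T"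
  by (rule finite_subset[of _ "X \<times> Y"]) (auto simp: rows.finite_carrier columns.finite_carrier)

lemma division_width_le:
  assumes P: "interval_partition r X P" and Q: "interval_partition s Y Q"
    and "finite T" "covers M T P Q" "\<And>A. A \<in> P \<Longrightarrow> card {t \<in> T. fst t \<in> A} \<le> k"
    "\<And>B. B \<in> Q \<Longrightarrow> card {t \<in> T. snd t \<in> B} \<le> k"
  shows "max_ones (quotient_matrix M) P Q \<le> k"
proof (rule max_ones_le[OF assms(3,4)])
  show "disjoint P" "disjoint Q"
    using P Q partition_onD2 unfolding interval_partition_def by blast+
  show "finite P" "finite Q"
    using rows.interval_partitionD(3)[OF P] columns.interval_partitionD(3)[OF Q] .
  show "P \<noteq> {}"
    using rows.interval_partitionD(1)[OF P] rows.nonempty by blast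
qed (use assms in auto)

text \<open>A part without representative can be merged with any neighbour. If there is none, the
  row parts of an adjacent pair of representatives are consecutive, and so are their column parts;
  merging first the rows and then the columns identifies the two ones and restores the
  invariant.\<close>

lemma contractible_if_matching:
  assumes "interval_partition r X P" "interval_partition s Y Q" "matching T P Q"
  shows "contractible r X s Y M 2 (P, Q)"
  using assms
proof (induction "card P + card Q" arbitrary: P Q T rule: less_induct)
  case less
  note P = less.prems(1) and Q = less.prems(2)
  note PD = rows.interval_partitionD[OF P] and QD = columns.interval_partitionD[OF Q]
  have T: "T \<subseteq> {(x, y) \<in> X \<times> Y. M x y}" "finite T" "covers M T P Q"
    "\<And>A. A \<in> P \<Longrightarrow> card {t \<in> T. fst t \<in> A} \<le> 1" "\<And>B. B \<in> Q \<Longrightarrow> card {t \<in> T. snd t \<in> B} \<le> 1"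
    using less.prems(3) finite_entries unfolding matching_def by auto
  have "max_ones (quotient_matrix M) P Q \<le> 1"
    by (rule division_width_le[OF P Q T(2,3)]) (use T(4,5) in auto)
  then have PQ: "is_division r X s Y (P, Q)" "max_ones (quotient_matrix M) (fst (P, Q)) (snd (P, Q)) \<le> 2"
    using P Q unfolding is_division_def by auto
  have mergesI: "merges R (insert (A \<union> B) (R - {A, B}))" if "A \<in> R" "B \<in> R" "A \<noteq> B" for A B :: "'c set" and R
    using that unfolding merges_def by blast
  \<comment> \<open>The side conditions exempt a partition with a single part, which admits no
    further merge and may lack a representative.\<close>
  consider (row) A where "A \<in> P" "P \<noteq> {A}" "{t \<in> T. fst t \<in> A} = {}"
    | (column) B where "B \<in> Q" "Q \<noteq> {B}" "{t \<in> T. snd t \<in> B} = {}"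
    | (full) "\<And>A. A \<in> P \<Longrightarrow> P \<noteq> {A} \<Longrightarrow> \<exists>t\<in>T. fst t \<in> A" "\<And>B. B \<in> Q \<Longrightarrow> Q \<noteq> {B} \<Longrightarrow> \<exists>t\<in>T. snd t \<in> B"
    by blast
  then show ?case
  proof cases
    case (row A)
    obtain B where B: "B \<in> P" "B \<noteq> A" and P': "interval_partition r X (insert (A \<union> B) (P - {A, B}))"
      using rows.interval_partition_neighbour[OF P row(1,2)] .
    have "card {t \<in> T. fst t \<in> A \<union> B} \<le> 0 + 1"
      by (rule card_merge_le[OF _ T(4)[OF B(1)]]) (simp only: row(3) card.empty)
    then have "matching T (insert (A \<union> B) (P - {A, B})) Q"
      using T covers_merge_rows[OF T(3) row(1) B(1)] unfolding matching_def by simp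
    then have "contractible r X s Y M 2 (insert (A \<union> B) (P - {A, B}), Q)"
      using less.hyps[OF _ P' Q] card_insert_merge_less[OF PD(3) row(1) B(1)] B(2) by auto
    then show ?thesis
      using contractible_step[OF _ PQ] mergesI[OF row(1) B(1)] B(2) by auto
  next
    case (column A)
    obtain B where B: "B \<in> Q" "B \<noteq> A" and Q': "interval_partition s Y (insert (A \<union> B) (Q - {A, B}))"
      using columns.interval_partition_neighbour[OF Q column(1,2)] .
    have "card {t \<in> T. snd t \<in> A \<union> B} \<le> 0 + 1"
      by (rule card_merge_le[OF _ T(5)[OF B(1)]]) (simp only: column(3) card.empty)
    then have "matching T P (insert (A \<union> B) (Q - {A, B}))"
      using T covers_merge_columns[OF T(3) column(1) B(1)] unfolding matching_def by simp
    then have "contractible r X s Y M 2 (P, insert (A \<union> B) (Q - {A, B}))"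
      using less.hyps[OF _ P Q'] card_insert_merge_less[OF QD(3) column(1) B(1)] B(2) by auto
    then show ?thesis
      using contractible_step[OF _ PQ] mergesI[OF column(1) B(1)] B(2) by auto
  next
    case full
    have same_row: "t = t'" if "A \<in> P" "t \<in> T" "t' \<in> T" "fst t \<in> A" "fst t' \<in> A" for A t t'
      using T(4)[OF that(1)] that(2-) unfolding card_le_1_iff[OF T(2)] by blast
    have same_column: "t = t'" if "B \<in> Q" "t \<in> T" "t' \<in> T" "snd t \<in> B" "snd t' \<in> B" for B t t'
      using T(5)[OF that(1)] that(2-) unfolding card_le_1_iff[OF T(2)] by blast
    show ?thesis
    proof (cases "\<exists>p\<in>T. \<exists>q\<in>T. p \<noteq> q")
      \<comment> \<open>With at most one representative, two distinct parts cannot both contain one,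
        so both partitions are already trivial.\<close>
      case False
      have "P = {A}" if "A \<in> P" for A
      proof (rule ccontr)
        assume "P \<noteq> {A}"
        then obtain B where "B \<in> P" "B \<noteq> A" "P \<noteq> {B}"
          using \<open>A \<in> P\<close> by blast
        then show False
          using full(1)[OF \<open>A \<in> P\<close> \<open>P \<noteq> {A}\<close>] full(1)[of B] False PD(4)[OF \<open>A \<in> P\<close> \<open>B \<in> P\<close>] by metis
      qed
      moreover have "P \<noteq> {}"
        using PD(1) rows.nonempty by blast
      ultimately have "P = {X}"
        using rows.interval_partition_eq_singleton P by (metis ex_in_conv)
      have "Q = {A}" if "A \<in> Q" for A
      proof (rule ccontr)
        assume "Q \<noteq> {A}"
        then obtain B where "B \<in> Q" "B \<noteq> A" "Q \<noteq> {B}"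
          using \<open>A \<in> Q\<close> by blast
        then show False
          using full(2)[OF \<open>A \<in> Q\<close> \<open>Q \<noteq> {A}\<close>] full(2)[of B] False QD(4)[OF \<open>A \<in> Q\<close> \<open>B \<in> Q\<close>] by metis
      qed
      moreover have "Q \<noteq> {}"
        using QD(1) columns.nonempty by blast
      ultimately have "Q = {Y}"
        using columns.interval_partition_eq_singleton Q by (metis ex_in_conv)
      with \<open>P = {X}\<close> PQ show ?thesis
        unfolding contractible_def by (intro exI[of _ "[({X}, {Y})]"]) auto
    next
      case True
      obtain p q where pq: "p \<in> T" "q \<in> T" "p \<noteq> q" and
        gap: "\<And>t. t \<in> T \<Longrightarrow> between (u (fst p)) (u (fst t)) (u (fst q)) \<or>
          between (v (snd p)) (v (snd t)) (v (snd q)) \<Longrightarrow> t = p \<or> t = q"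
        using adjacent[OF T(1) True] by blast
      have entry: "fst t \<in> X" "snd t \<in> Y" if "t \<in> T" for t
        using T(1) that by auto
      obtain A B where AB: "A \<in> P" "fst p \<in> A" "B \<in> P" "fst q \<in> B"
        using entry(1) pq(1,2) PD(1) by (metis UnionE)
      obtain C D where CD: "C \<in> Q" "snd p \<in> C" "D \<in> Q" "snd q \<in> D"
        using entry(2) pq(1,2) QD(1) by (metis UnionE)
      have "A \<noteq> B" "C \<noteq> D"
        using same_row same_column AB CD pq by blast+
      define P' where "P' = insert (A \<union> B) (P - {A, B})"
      define Q' where "Q' = insert (C \<union> D) (Q - {C, D})"
      have P': "interval_partition r X P'"
        unfolding P'_def
      proof (rule rows.interval_partition_merge[OF P AB(1,3) \<open>A \<noteq> B\<close> AB(2,4)], rule ccontr)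
        \<comment> \<open>The part \<open>E\<close> of such a \<open>w\<close> is an interval
          avoiding \<open>fst p\<close> and \<open>fst q\<close>, so it lies between them as a
          whole. Its representative then contradicts the choice of \<open>p\<close> and
          \<open>q\<close>.\<close>
        fix w assume w: "w \<in> X" "between (u (fst p)) (u w) (u (fst q))" "w \<notin> A \<union> B"
        obtain E where E: "E \<in> P" "w \<in> E"
          using w(1) PD(1) by blast
        then obtain t where t: "t \<in> T" "fst t \<in> E"
          using full(1)[OF E(1)] AB \<open>A \<noteq> B\<close> by blast
        have "E \<noteq> A" "E \<noteq> B"
          using E w(3) by blast+
        then have out: "fst p \<notin> E" "fst q \<notin> E"
          using PD(4)[OF E(1) AB(1)] PD(4)[OF E(1) AB(3)] AB by blast+
        then have "\<not> between (u w) (u (fst p)) (u (fst t))" "\<not> between (u w) (u (fst q)) (u (fst t))"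
          using PD(5)[OF E t(2)] entry(1) pq by blast+
        then have "between (u (fst p)) (u (fst t)) (u (fst q))"
          using w(2) by linarith
        then show False
          using gap[OF t(1)] out t(2) by blast
      qed
      have Q': "interval_partition s Y Q'"
        unfolding Q'_def
      proof (rule columns.interval_partition_merge[OF Q CD(1,3) \<open>C \<noteq> D\<close> CD(2,4)], rule ccontr)
        fix w assume w: "w \<in> Y" "between (v (snd p)) (v w) (v (snd q))" "w \<notin> C \<union> D"
        obtain E where E: "E \<in> Q" "w \<in> E"
          using w(1) QD(1) by blast
        then obtain t where t: "t \<in> T" "snd t \<in> E"
          using full(2)[OF E(1)] CD \<open>C \<noteq> D\<close> by blast
        have "E \<noteq> C" "E \<noteq> D"
          using E w(3) by blast+
        then have out: "snd p \<notin> E" "snd q \<notin> E"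
          using QD(4)[OF E(1) CD(1)] QD(4)[OF E(1) CD(3)] CD by blast+
        then have "\<not> between (v w) (v (snd p)) (v (snd t))" "\<not> between (v w) (v (snd q)) (v (snd t))"
          using QD(5)[OF E t(2)] entry(2) pq by blast+
        then have "between (v (snd p)) (v (snd t)) (v (snd q))"
          using w(2) by linarith
        then show False
          using gap[OF t(1)] out t(2) by blast
      qed
      have row_cover: "covers M T P' Q"
        unfolding P'_def by (rule covers_merge_rows[OF T(3) AB(1,3)])
      \<comment> \<open>With the rows merged but not yet the columns, the row
        \<open>A \<union> B\<close> may have two ones. Only such intermediate divisions need the
        bound 2; those satisfying the invariant have width at most 1.\<close>
      have row_card: "card {t \<in> T. fst t \<in> E} \<le> 2" if "E \<in> P'" for E
        using that T(4) card_merge_le[OF T(4)[OF AB(1)] T(4)[OF AB(3)]] unfolding P'_def by fastforce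
      have "max_ones (quotient_matrix M) P' Q \<le> 2"
        using division_width_le[OF P' Q T(2) row_cover row_card] T(5) by fastforce
      then have P'Q: "is_division r X s Y (P', Q)" "max_ones (quotient_matrix M) (fst (P', Q)) (snd (P', Q)) \<le> 2"
        using P' Q unfolding is_division_def by auto
      have finite: "finite (T - {q})"
        using T(2) by simp
      \<comment> \<open>After both merges \<open>p\<close> and \<open>q\<close> lie in the same
        cell, so \<open>q\<close> is dropped and \<open>p\<close> represents the cell alone.\<close>
      have old: "t = p" if "t \<in> T - {q}" "fst t \<in> A \<union> B \<or> snd t \<in> C \<union> D" for t
        using that same_row[OF AB(1)] same_row[OF AB(3)] same_column[OF CD(1)] same_column[OF CD(3)]
          AB CD pq by blast
      have "card {t \<in> T - {q}. fst t \<in> E} \<le> 1" if "E \<in> P'" for E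
        unfolding card_le_1_iff[OF finite]
        using that same_row[of E] old unfolding P'_def by (metis DiffE UnCI insert_iff)
      moreover have "card {t \<in> T - {q}. snd t \<in> E} \<le> 1" if "E \<in> Q'" for E
        unfolding card_le_1_iff[OF finite]
        using that same_column[of E] old unfolding Q'_def by (metis DiffE UnCI insert_iff)
      moreover have "covers M (T - {q}) P' Q'"
        unfolding covers_def
      proof (intro ballI impI)
        fix E F assume EF: "E \<in> P'" "F \<in> Q'" "quotient_matrix M E F"
        have "covers M T P' Q'"
          unfolding Q'_def by (rule covers_merge_columns[OF row_cover CD(1,3)])
        then obtain t where t: "t \<in> T" "fst t \<in> E" "snd t \<in> F"
          using EF unfolding covers_def by blast
        show "\<exists>t\<in>T - {q}. fst t \<in> E \<and> snd t \<in> F"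
        proof (cases "t = q")
          case True
          have "A \<union> B \<in> P'" "C \<union> D \<in> Q'"
            unfolding P'_def Q'_def by auto
          then have "E = A \<union> B" "F = C \<union> D"
            using rows.interval_partitionD(4)[OF P' EF(1)] columns.interval_partitionD(4)[OF Q' EF(2)]
              t(2,3) True AB CD by blast+
          then show ?thesis
            using pq AB CD by blast
        qed (use t in blast)
      qed
      ultimately have "matching (T - {q}) P' Q'"
        using T(1) unfolding matching_def by auto
      moreover have "card P' < card P" "card Q' < card Q"
        unfolding P'_def Q'_def
        using card_insert_merge_less PD(3) QD(3) AB CD \<open>A \<noteq> B\<close> \<open>C \<noteq> D\<close> by metis+
      ultimately have "contractible r X s Y M 2 (P', Q')"
        using less.hyps[OF _ P' Q'] by simp
      then have "contractible r X s Y M 2 (P', Q)"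
        using contractible_step[OF _ P'Q] mergesI[OF CD(1,3) \<open>C \<noteq> D\<close>] unfolding Q'_def by auto
      then show ?thesis
        using contractible_step[OF _ PQ] mergesI[OF AB(1,3) \<open>A \<noteq> B\<close>] unfolding P'_def by auto
    qed
  qed
qed

lemma stww_finite_le_2: "stww_finite r X s Y M \<le> 2"
proof -
  define T where "T = {(x, y) \<in> X \<times> Y. M x y}"
  have "finite T"
    using finite_entries unfolding T_def by blast
  then have "matching T (singletons X) (singletons Y)"
    using row_unique column_unique unfolding matching_def covers_def quotient_matrix_def singletons_def
    by (auto simp: card_le_Suc0_iff_eq T_def)
  then have "contractible r X s Y M 2 (singletons X, singletons Y)"
    by (intro contractible_if_matching rows.interval_partition_singletons
        columns.interval_partition_singletons)
  then show ?thesis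
    using contractible_imp_stww_finite_le by (fastforce simp: numeral_eq_enat)
qed

end

section \<open>Separable orders on solvable groups\<close>

text \<open>\<open>r\<close> occurs only positively, so a decomposition persists in any larger
  order. The images are compared by the reflexive order; for translations, strictness comes from
  cancellation in the group.\<close>

definition decomposes :: "'a rel \<Rightarrow> ('a \<Rightarrow> 'a) \<Rightarrow> 'a set \<Rightarrow> bool" where
  "decomposes r f S \<longleftrightarrow>
     (\<exists>A B. A \<noteq> {} \<and> B \<noteq> {} \<and> A \<union> B = S \<and> (\<forall>a\<in>A. \<forall>b\<in>B. a \<noteq> b \<and> (a, b) \<in> r) \<and>
       ((\<forall>a\<in>A. \<forall>b\<in>B. (f a, f b) \<in> r) \<or> (\<forall>a\<in>A. \<forall>b\<in>B. (f b, f a) \<in> r)))"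

text \<open>The relation carries its own domain, so ordered subgroups are compared by inclusion of
  relations. The translating elements \<open>g\<close> are taken from this domain as well.\<close>

definition separable_order :: "('a, 'b) monoid_scheme \<Rightarrow> 'a rel \<Rightarrow> bool" where
  "separable_order G r \<longleftrightarrow> Linear_order r \<and>
     (\<forall>g\<in>Field r. \<forall>S\<subseteq>Field r. finite S \<longrightarrow> (\<exists>x\<in>S. \<exists>y\<in>S. x \<noteq> y) \<longrightarrow>
       decomposes r (\<lambda>x. x \<otimes>\<^bsub>G\<^esub> g) S)"

lemma decomposes_mono:
  assumes "decomposes r f S" "r \<subseteq> r'"
  shows "decomposes r' f S"
proof -
  obtain A B where "A \<noteq> {} \<and> B \<noteq> {} \<and> A \<union> B = S \<and> (\<forall>a\<in>A. \<forall>b\<in>B. a \<noteq> b \<and> (a, b) \<in> r) \<and>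
      ((\<forall>a\<in>A. \<forall>b\<in>B. (f a, f b) \<in> r) \<or> (\<forall>a\<in>A. \<forall>b\<in>B. (f b, f a) \<in> r))"
    using assms(1) unfolding decomposes_def by (elim exE)
  then show ?thesis
    unfolding decomposes_def using assms(2) by (intro exI[of _ A] exI[of _ B]) auto
qed

text \<open>In the application to groups, \<open>\<kappa>\<close> is the number of the coset of an
  element and \<open>\<tau>\<close> its component in the smaller subgroup.\<close>

definition lexicographic_order :: "'a set \<Rightarrow> ('a \<Rightarrow> int) \<Rightarrow> ('a \<Rightarrow> 'b) \<Rightarrow> 'b rel \<Rightarrow> 'a rel" where
  "lexicographic_order H \<kappa> \<tau> r =
     {(x, y) \<in> H \<times> H. \<kappa> x < \<kappa> y \<or> \<kappa> x = \<kappa> y \<and> (\<tau> x, \<tau> y) \<in> r}"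

lemma linear_order_on_lexicographic_order:
  assumes "Linear_order r" and "\<tau> ` H \<subseteq> Field r"
    and inj: "\<And>x y. x \<in> H \<Longrightarrow> y \<in> H \<Longrightarrow> \<kappa> x = \<kappa> y \<Longrightarrow> \<tau> x = \<tau> y \<Longrightarrow> x = y"
  shows "linear_order_on H (lexicographic_order H \<kappa> \<tau> r)"
proof -
  have r: "refl_on (Field r) r" "trans r" "antisym r" "total_on (Field r) r"
    using assms(1) by (auto simp: order_on_defs)
  have refl: "(\<tau> x, \<tau> x) \<in> r" if "x \<in> H" for x
    using r(1) assms(2) that by (auto dest: refl_onD)
  have "trans (lexicographic_order H \<kappa> \<tau> r)"
    unfolding lexicographic_order_def using r(2) by (intro transI) (auto dest: transD)
  moreover have "antisym (lexicographic_order H \<kappa> \<tau> r)"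
    unfolding lexicographic_order_def using inj r(3) by (intro antisymI) (auto dest: antisymD)
  moreover have "total_on H (lexicographic_order H \<kappa> \<tau> r)"
  proof (rule total_onI)
    fix x y assume xy: "x \<in> H" "y \<in> H" "x \<noteq> y"
    then have "\<kappa> x = \<kappa> y \<Longrightarrow> (\<tau> x, \<tau> y) \<in> r \<or> (\<tau> y, \<tau> x) \<in> r"
      using inj r(4) assms(2) unfolding total_on_def by (metis image_subset_iff)
    with xy(1,2) show "(x, y) \<in> lexicographic_order H \<kappa> \<tau> r \<or> (y, x) \<in> lexicographic_order H \<kappa> \<tau> r"
      unfolding lexicographic_order_def by auto
  qed
  ultimately show ?thesis
    unfolding order_on_defs by (auto simp: lexicographic_order_def refl intro: refl_onI)
qed

text \<open>
  \<open>\<phi>\<close> models a translation of an interval of integers modulo its length, and \<open>W\<close> consists of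
  the levels at which the translation wraps around.
\<close>

lemma separable_order_lexicographic:
  assumes r: "separable_order G r" and \<tau>: "\<tau> ` H \<subseteq> Field r"
    and inj: "\<And>x y. x \<in> H \<Longrightarrow> y \<in> H \<Longrightarrow> \<kappa> x = \<kappa> y \<Longrightarrow> \<tau> x = \<tau> y \<Longrightarrow> x = y"
    and closed: "\<And>x g. x \<in> H \<Longrightarrow> g \<in> H \<Longrightarrow> x \<otimes>\<^bsub>G\<^esub> g \<in> H"
    and translation: "\<And>g. g \<in> H \<Longrightarrow> \<exists>\<phi> m W.
      (\<forall>x\<in>H. m (\<kappa> x) \<in> Field r \<and> \<kappa> (x \<otimes>\<^bsub>G\<^esub> g) = \<phi> (\<kappa> x) \<and> \<tau> (x \<otimes>\<^bsub>G\<^esub> g) = \<tau> x \<otimes>\<^bsub>G\<^esub> m (\<kappa> x)) \<and>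
      (\<forall>k\<in>\<kappa> ` H. \<forall>l\<in>\<kappa> ` H. k < l \<longrightarrow> (k \<in> W \<longrightarrow> l \<in> W) \<and>
        ((k \<in> W \<longleftrightarrow> l \<in> W) \<longrightarrow> \<phi> k < \<phi> l) \<and> (k \<notin> W \<longrightarrow> l \<in> W \<longrightarrow> \<phi> l < \<phi> k))"
  shows "separable_order G (lexicographic_order H \<kappa> \<tau> r)"
proof -
  let ?r = "lexicographic_order H \<kappa> \<tau> r"
  have "Linear_order r"
    using r by (simp add: separable_order_def)
  then have linear: "linear_order_on H ?r"
    using \<tau> inj by (rule linear_order_on_lexicographic_order)
  then have Field: "Field ?r = H"
    by (auto simp: order_on_defs Field_def refl_on_def)
  have "decomposes ?r (\<lambda>x. x \<otimes>\<^bsub>G\<^esub> g) S"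
    if g: "g \<in> H" and S: "S \<subseteq> H" "finite S" "\<exists>x\<in>S. \<exists>y\<in>S. x \<noteq> y" for g S
  proof -
    obtain \<phi> m W where *:
      "\<forall>x\<in>H. m (\<kappa> x) \<in> Field r \<and> \<kappa> (x \<otimes>\<^bsub>G\<^esub> g) = \<phi> (\<kappa> x) \<and> \<tau> (x \<otimes>\<^bsub>G\<^esub> g) = \<tau> x \<otimes>\<^bsub>G\<^esub> m (\<kappa> x)"
      "\<forall>k\<in>\<kappa> ` H. \<forall>l\<in>\<kappa> ` H. k < l \<longrightarrow> (k \<in> W \<longrightarrow> l \<in> W) \<and>
        ((k \<in> W \<longleftrightarrow> l \<in> W) \<longrightarrow> \<phi> k < \<phi> l) \<and> (k \<notin> W \<longrightarrow> l \<in> W \<longrightarrow> \<phi> l < \<phi> k)"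
      using translation[OF g] by (elim exE conjE)
    have
      m: "\<And>x. x \<in> H \<Longrightarrow> m (\<kappa> x) \<in> Field r" and
      \<phi>: "\<And>x. x \<in> H \<Longrightarrow> \<kappa> (x \<otimes>\<^bsub>G\<^esub> g) = \<phi> (\<kappa> x)" and
      \<tau>g: "\<And>x. x \<in> H \<Longrightarrow> \<tau> (x \<otimes>\<^bsub>G\<^esub> g) = \<tau> x \<otimes>\<^bsub>G\<^esub> m (\<kappa> x)" and
      W: "\<And>x y. x \<in> H \<Longrightarrow> y \<in> H \<Longrightarrow> \<kappa> x < \<kappa> y \<Longrightarrow> \<kappa> x \<in> W \<Longrightarrow> \<kappa> y \<in> W" and
      same: "\<And>x y. x \<in> H \<Longrightarrow> y \<in> H \<Longrightarrow> \<kappa> x < \<kappa> y \<Longrightarrow> (\<kappa> x \<in> W \<longleftrightarrow> \<kappa> y \<in> W) \<Longrightarrow> \<phi> (\<kappa> x) < \<phi> (\<kappa> y)" and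
      diff: "\<And>x y. x \<in> H \<Longrightarrow> y \<in> H \<Longrightarrow> \<kappa> x < \<kappa> y \<Longrightarrow> \<kappa> x \<notin> W \<Longrightarrow> \<kappa> y \<in> W \<Longrightarrow> \<phi> (\<kappa> y) < \<phi> (\<kappa> x)"
      using * by simp_all
    have lessI: "(x, y) \<in> ?r" if "x \<in> H" "y \<in> H" "\<kappa> x < \<kappa> y" for x y
      using that by (simp add: lexicographic_order_def)
    \<comment> \<open>If \<open>S\<close> has levels that wrap around and levels that do not, these
      two groups of levels are exchanged. Otherwise \<open>\<phi>\<close> is increasing on the
      levels of \<open>S\<close>, and any cut between two levels works. A single level is left to
      the order \<open>r\<close>.\<close>
    consider "\<exists>x\<in>S. \<exists>y\<in>S. \<kappa> x \<notin> W \<and> \<kappa> y \<in> W"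
      | x y where "\<forall>x\<in>S. \<forall>y\<in>S. \<kappa> x \<in> W \<longleftrightarrow> \<kappa> y \<in> W" "x \<in> S" "y \<in> S" "\<kappa> x < \<kappa> y"
      | "\<forall>x\<in>S. \<forall>y\<in>S. \<kappa> x = \<kappa> y"
      by (metis linorder_neqE)
    then show ?thesis
    proof cases
      case 1
      let ?A = "{x \<in> S. \<kappa> x \<notin> W}" and ?B = "{x \<in> S. \<kappa> x \<in> W}"
      have less: "\<kappa> a < \<kappa> b" if "a \<in> ?A" "b \<in> ?B" for a b
        using W[of b a] that S(1) by (cases "\<kappa> a" "\<kappa> b" rule: linorder_cases) auto
      have "(a, b) \<in> ?r" "(b \<otimes>\<^bsub>G\<^esub> g, a \<otimes>\<^bsub>G\<^esub> g) \<in> ?r" if "a \<in> ?A" "b \<in> ?B" for a b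
      proof -
        have "a \<in> H" "b \<in> H"
          using that S(1) by auto
        then show "(a, b) \<in> ?r" "(b \<otimes>\<^bsub>G\<^esub> g, a \<otimes>\<^bsub>G\<^esub> g) \<in> ?r"
          using less[OF that] that diff[of a b] \<phi> g closed by (auto intro!: lessI)
      qed
      then show ?thesis
        unfolding decomposes_def using 1 by (intro exI[of _ ?A] exI[of _ ?B]) auto
    next
      case (2 x y)
      let ?A = "{z \<in> S. \<kappa> z < \<kappa> y}" and ?B = "{z \<in> S. \<kappa> y \<le> \<kappa> z}"
      have "(a, b) \<in> ?r" "(a \<otimes>\<^bsub>G\<^esub> g, b \<otimes>\<^bsub>G\<^esub> g) \<in> ?r" if "a \<in> ?A" "b \<in> ?B" for a b
      proof -
        have "a \<in> H" "b \<in> H" "\<kappa> a < \<kappa> b" "\<kappa> a \<in> W \<longleftrightarrow> \<kappa> b \<in> W"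
          using that S(1) 2(1) by auto
        then show "(a, b) \<in> ?r" "(a \<otimes>\<^bsub>G\<^esub> g, b \<otimes>\<^bsub>G\<^esub> g) \<in> ?r"
          using same[of a b] \<phi> g closed by (auto intro!: lessI)
      qed
      moreover have "?A \<noteq> {}" "?B \<noteq> {}" "?A \<union> ?B = S"
        using 2 by auto
      ultimately show ?thesis
        unfolding decomposes_def by (intro exI[of _ ?A] exI[of _ ?B]) auto
    next
      case 3
      \<comment> \<open>On one level \<open>\<tau>\<close> is injective, and translation by
        \<open>g\<close> acts on the values of \<open>\<tau>\<close> as right multiplication by
        \<open>m (\<kappa> x0)\<close>. A decomposition of the image of \<open>S\<close> under
        \<open>\<tau>\<close> is pulled back.\<close>
      obtain x0 where x0: "x0 \<in> S"
        using S(3) by blast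
      have \<kappa>: "\<kappa> x = \<kappa> x0" if "x \<in> S" for x
        using 3 that x0 by blast
      have "\<exists>x\<in>\<tau> ` S. \<exists>y\<in>\<tau> ` S. x \<noteq> y"
        using S inj \<kappa> by (metis imageI subsetD)
      then have "decomposes r (\<lambda>x. x \<otimes>\<^bsub>G\<^esub> m (\<kappa> x0)) (\<tau> ` S)"
        using r m[of x0] x0 S \<tau> unfolding separable_order_def by (meson finite_imageI image_mono order_trans subsetD)
      then obtain A B where AB: "A \<noteq> {}" "B \<noteq> {}" "A \<union> B = \<tau> ` S"
        "\<And>a b. a \<in> A \<Longrightarrow> b \<in> B \<Longrightarrow> a \<noteq> b \<and> (a, b) \<in> r"
        "(\<forall>a\<in>A. \<forall>b\<in>B. (a \<otimes>\<^bsub>G\<^esub> m (\<kappa> x0), b \<otimes>\<^bsub>G\<^esub> m (\<kappa> x0)) \<in> r) \<or>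
         (\<forall>a\<in>A. \<forall>b\<in>B. (b \<otimes>\<^bsub>G\<^esub> m (\<kappa> x0), a \<otimes>\<^bsub>G\<^esub> m (\<kappa> x0)) \<in> r)"
        unfolding decomposes_def by metis
      have r_iff: "(x, y) \<in> ?r \<longleftrightarrow> (\<tau> x, \<tau> y) \<in> r" if "x \<in> S" "y \<in> S" for x y
        using that S(1) \<kappa> by (auto simp: lexicographic_order_def)
      have g_iff: "(x \<otimes>\<^bsub>G\<^esub> g, y \<otimes>\<^bsub>G\<^esub> g) \<in> ?r \<longleftrightarrow> (\<tau> x \<otimes>\<^bsub>G\<^esub> m (\<kappa> x0), \<tau> y \<otimes>\<^bsub>G\<^esub> m (\<kappa> x0)) \<in> r"
        if "x \<in> S" "y \<in> S" for x y
        using that S(1) \<kappa> closed g \<phi> \<tau>g by (auto simp: lexicographic_order_def subset_iff)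
      let ?A = "{x \<in> S. \<tau> x \<in> A}" and ?B = "{x \<in> S. \<tau> x \<in> B}"
      have "A \<subseteq> \<tau> ` S" "B \<subseteq> \<tau> ` S" "\<tau> ` S \<subseteq> A \<union> B"
        using AB(3) by auto
      then have "?A \<noteq> {}" "?B \<noteq> {}" "?A \<union> ?B = S"
        using AB(1,2) by fast+
      moreover have "\<forall>a\<in>?A. \<forall>b\<in>?B. a \<noteq> b \<and> (a, b) \<in> ?r"
        using AB(4) r_iff by blast
      moreover have "(\<forall>a\<in>?A. \<forall>b\<in>?B. (a \<otimes>\<^bsub>G\<^esub> g, b \<otimes>\<^bsub>G\<^esub> g) \<in> ?r) \<or>
          (\<forall>a\<in>?A. \<forall>b\<in>?B. (b \<otimes>\<^bsub>G\<^esub> g, a \<otimes>\<^bsub>G\<^esub> g) \<in> ?r)"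
        using AB(5) by (simp add: g_iff) blast
      ultimately show ?thesis
        unfolding decomposes_def by (intro exI[of _ ?A] exI[of _ ?B] conjI)
    qed
  qed
  with linear show ?thesis
    unfolding separable_order_def by (simp add: Field)
qed

section \<open>Exponents and their residues\<close>

text \<open>A subgroup of the integers is generated by its gcd, which is \<open>0\<close> for the
  zero subgroup.\<close>

lemma int_set_eq_multiples:
  fixes A :: "int set"
  assumes "0 \<in> A" "\<And>x y. x \<in> A \<Longrightarrow> y \<in> A \<Longrightarrow> x - y \<in> A"
  obtains n where "n \<ge> 0" "\<And>k. k \<in> A \<longleftrightarrow> n dvd k"
proof
  have "group_closure A = A"
  proof
    show "group_closure A \<subseteq> A"
    proof
      fix x assume "x \<in> group_closure A"
      then show "x \<in> A"
        by induction (use assms in auto)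
    qed
    show "A \<subseteq> group_closure A"
      by (simp add: group_closure.base subset_iff)
  qed
  then show "k \<in> A \<longleftrightarrow> Gcd A dvd k" for k
    using group_closure_eq[of A] by (auto simp: dvd_def)
qed simp

text \<open>The condition \<open>k mod n = k\<close> says that \<open>k\<close> lies in
  \<open>{0..<n}\<close> if \<open>n > 0\<close>; it holds for all integers if \<open>n = 0\<close>,
  which covers infinite cyclic quotients. The sum \<open>k + j\<close> is reduced by
  \<open>n\<close> exactly if it wraps, so two residues that both wrap or both do not keep their
  order.\<close>

lemma mod_translation_less:
  fixes k l j n :: int
  assumes "n \<ge> 0" "k mod n = k" "l mod n = l" "j mod n = j" "k < l"
    and "(0 < n \<and> n \<le> k + j) \<longleftrightarrow> (0 < n \<and> n \<le> l + j)"
  shows "(k + j) mod n < (l + j) mod n"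
proof (cases "n = 0")
  case True
  then show ?thesis
    using assms(5) by simp
next
  case False
  then have n: "n > 0"
    using assms(1) by simp
  have bounds: "0 \<le> k" "0 \<le> l" "0 \<le> j" "k < n" "l < n" "j < n"
    using assms(2-4) n by (metis pos_mod_bound pos_mod_sign)+
  have wrap: "i mod n = i - n" if "n \<le> i" "i < 2 * n" for i
    using that n mod_pos_pos_trivial[of "i - n" n] by (simp add: mod_diff_right_eq[symmetric])
  show ?thesis
    using assms(5,6) bounds n wrap[of "k + j"] wrap[of "l + j"] by (cases "n \<le> k + j") auto
qed

text \<open>A sum that wraps is reduced to a value below \<open>j\<close>, while one that does not
  is at least \<open>j\<close>.\<close>

lemma mod_translation_wrap:
  fixes k l j n :: int
  assumes "k mod n = k" "l mod n = l" "j mod n = j"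
    and "\<not> (0 < n \<and> n \<le> k + j)" "0 < n \<and> n \<le> l + j"
  shows "(l + j) mod n < (k + j) mod n"
proof -
  have n: "n > 0"
    using assms(5) by simp
  have bounds: "0 \<le> k" "0 \<le> l" "0 \<le> j" "k < n" "l < n" "j < n"
    using assms(1-3) n by (metis pos_mod_bound pos_mod_sign)+
  have wrap: "i mod n = i - n" if "n \<le> i" "i < 2 * n" for i
    using that n mod_pos_pos_trivial[of "i - n" n] by (simp add: mod_diff_right_eq[symmetric])
  show ?thesis
    using assms(4,5) bounds n wrap[of "l + j"] by auto
qed

section \<open>Extending separable orders to larger subgroups\<close>

context group
begin

text \<open>Let \<open>L\<close> be the field of \<open>r\<close>, and let \<open>n\<close> generate
  the group of exponents \<open>k\<close> with \<open>a [^] k\<close> in \<open>L\<close>. Every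
  element of \<open>H\<close> is \<open>h \<otimes> a [^] k\<close> for a unique \<open>h\<close> in
  \<open>L\<close> and a unique \<open>k\<close> reduced modulo \<open>n\<close>; the functions
  \<open>\<kappa>\<close> and \<open>\<tau>\<close> return \<open>k\<close> and
  \<open>h\<close>.\<close>

lemma separable_order_cyclic_extension:
  assumes r: "separable_order G r" and L: "subgroup (Field r) G" and a: "a \<in> carrier G"
    and normal: "\<And>k h. h \<in> Field r \<Longrightarrow> a [^] (k::int) \<otimes> h \<otimes> a [^] (- k) \<in> Field r"
  obtains r' where "separable_order G r'" "r \<subseteq> r'" "subgroup (Field r') G" "a \<in> Field r'"
    "Field r' \<subseteq> {h \<otimes> a [^] k |h (k::int). h \<in> Field r}"
proof -
  let ?L = "Field r"
  interpret L: subgroup ?L G by (rule L)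
  define H where "H = {x \<in> carrier G. \<exists>k::int. x \<otimes> a [^] (- k) \<in> ?L}"
  have pow: "a [^] (k::int) \<in> carrier G" for k
    using a by simp
  have pow_add: "a [^] (k + l) = a [^] k \<otimes> a [^] l" for k l :: int
    using int_pow_mult a by auto
  have pow_cancel: "a [^] k \<otimes> a [^] (- k) = \<one>" "a [^] (- k) \<otimes> a [^] k = \<one>" for k :: int
    using pow_add[of k "- k"] pow_add[of "- k" k] by simp_all
  have "\<one> \<in> ?L" "a [^] (x - y) \<in> ?L" if "a [^] x \<in> ?L" "a [^] y \<in> ?L" for x y :: int
    using that a by (simp_all add: int_pow_diff)
  then obtain n where n: "n \<ge> 0" "\<And>k::int. a [^] k \<in> ?L \<longleftrightarrow> n dvd k"
    using int_set_eq_multiples[of "{k. a [^] k \<in> ?L}"] by (metis L.one_closed int_pow_0 mem_Collect_eq)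
  have decomp: "x = x \<otimes> a [^] (- k) \<otimes> a [^] k" if "x \<in> carrier G" for x and k :: int
    using that pow pow_cancel by (simp add: m_assoc)
  have shift: "x \<otimes> a [^] (- l) \<in> ?L" if "x \<in> carrier G" "x \<otimes> a [^] (- k) \<in> ?L" "n dvd k - l" for x and k l :: int
  proof -
    have "x \<otimes> a [^] (- l) = x \<otimes> a [^] (- k) \<otimes> a [^] (k - l)"
      using that(1) pow pow_add[of "- k" "k - l"] by (simp add: m_assoc)
    then show ?thesis
      using that n(2) by simp
  qed
  define \<kappa> where "\<kappa> x = (THE k. x \<otimes> a [^] (- k) \<in> ?L \<and> k mod n = k)" for x
  have unique: "n dvd k - l" if "x \<in> carrier G" "x \<otimes> a [^] (- k) \<in> ?L" "x \<otimes> a [^] (- l) \<in> ?L" for x and k l :: int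
  proof -
    have "inv x \<otimes> (x \<otimes> y) = y" if "y \<in> carrier G" for y
      using \<open>x \<in> carrier G\<close> that by (simp add: m_assoc[symmetric])
    then have "a [^] (k - l) = inv (x \<otimes> a [^] (- k)) \<otimes> (x \<otimes> a [^] (- l))"
      using that(1) pow a by (simp add: inv_mult_group int_pow_neg m_assoc int_pow_diff)
    then have "a [^] (k - l) \<in> ?L"
      using that(2,3) by simp
    then show ?thesis
      using n(2) by blast
  qed
  have \<kappa>_eq: "\<kappa> x = k mod n" if "x \<in> carrier G" "x \<otimes> a [^] (- k) \<in> ?L" for x k
    unfolding \<kappa>_def
  proof (rule the_equality)
    show "x \<otimes> a [^] (- (k mod n)) \<in> ?L \<and> k mod n mod n = k mod n"
      using shift[OF that] by (simp add: minus_mod_eq_mult_div)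
    show "l = k mod n" if "x \<otimes> a [^] (- l) \<in> ?L \<and> l mod n = l" for l
      using unique[of x l k] that \<open>x \<in> carrier G\<close> \<open>x \<otimes> a [^] (- k) \<in> ?L\<close> by (metis mod_eq_dvd_iff)
  qed
  have \<kappa>: "x \<otimes> a [^] (- \<kappa> x) \<in> ?L" "\<kappa> x mod n = \<kappa> x" if x: "x \<in> H" for x
  proof -
    obtain k :: int where k: "x \<in> carrier G" "x \<otimes> a [^] (- k) \<in> ?L"
      using x unfolding H_def by blast
    show "x \<otimes> a [^] (- \<kappa> x) \<in> ?L" "\<kappa> x mod n = \<kappa> x"
      unfolding \<kappa>_eq[OF k] using shift[OF k, of "k mod n"] by (simp_all add: minus_mod_eq_mult_div)
  qed
  define \<tau> where "\<tau> x = x \<otimes> a [^] (- \<kappa> x)" for x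
  have H_carrier: "x \<in> carrier G" if "x \<in> H" for x
    using that by (simp add: H_def)
  \<comment> \<open>The component of a product in \<open>L\<close>: that of \<open>x\<close>, times
    the conjugate by \<open>a [^] k\<close> of that of \<open>g\<close>, times a power
    \<open>a [^] d\<close> that compensates for reducing the exponent \<open>k + l\<close>.\<close>
  have product: "x \<otimes> g \<otimes> a [^] (- (k + l) + d) =
      (x \<otimes> a [^] (- k)) \<otimes> (a [^] k \<otimes> (g \<otimes> a [^] (- l)) \<otimes> a [^] (- k) \<otimes> a [^] d)"
    if "x \<in> carrier G" "g \<in> carrier G" for x g and k l d :: int
  proof -
    have "(x \<otimes> a [^] (- k)) \<otimes> (a [^] k \<otimes> (g \<otimes> a [^] (- l)) \<otimes> a [^] (- k) \<otimes> a [^] d) =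
        (x \<otimes> a [^] (- k) \<otimes> a [^] k) \<otimes> (g \<otimes> (a [^] (- l) \<otimes> a [^] (- k) \<otimes> a [^] d))"
      using that pow by (simp add: m_assoc)
    also have "\<dots> = x \<otimes> g \<otimes> a [^] (- (k + l) + d)"
      using that pow decomp[of x k] by (simp add: m_assoc pow_add[symmetric] algebra_simps)
    finally show ?thesis by simp
  qed
  have factor: "a [^] k \<otimes> h \<otimes> a [^] (- k) \<otimes> a [^] d \<in> ?L" if "h \<in> ?L" "n dvd d" for h and k d :: int
    using normal[OF that(1), of k] n(2)[of d] that(2) L.m_closed by blast
  have product_mem: "x \<otimes> g \<otimes> a [^] (- (\<kappa> x + \<kappa> g)) \<in> ?L" if "x \<in> H" "g \<in> H" for x g
    using product[OF that[THEN H_carrier], of "\<kappa> x" "\<kappa> g" 0]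
      L.m_closed[OF \<kappa>(1)[OF that(1)] factor[OF \<kappa>(1)[OF that(2)], of 0]] by simp
  have closed: "x \<otimes> g \<in> H" if "x \<in> H" "g \<in> H" for x g
    using product_mem[OF that] that[THEN H_carrier] unfolding H_def by blast
  have \<kappa>_mult: "\<kappa> (x \<otimes> g) = (\<kappa> x + \<kappa> g) mod n" if "x \<in> H" "g \<in> H" for x g
    by (rule \<kappa>_eq[OF _ product_mem[OF that]]) (use that H_carrier in auto)
  let ?r = "lexicographic_order H \<kappa> \<tau> r"
  have \<tau>: "\<tau> ` H \<subseteq> ?L"
    using \<kappa>(1) unfolding \<tau>_def by blast
  have inj: "x = y" if "x \<in> H" "y \<in> H" "\<kappa> x = \<kappa> y" "\<tau> x = \<tau> y" for x y
    using that H_carrier decomp[of x "\<kappa> x"] decomp[of y "\<kappa> y"] unfolding \<tau>_def by metis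
  have sep: "separable_order G ?r"
  proof (rule separable_order_lexicographic[OF r \<tau> inj closed])
    fix g assume g: "g \<in> H"
    let ?j = "\<kappa> g"
    \<comment> \<open>The right factor in \<open>product\<close>, with \<open>d\<close> the multiple
      of \<open>n\<close> removed by reduction; it depends on \<open>x\<close> only through its
      level. The levels themselves are shifted by \<open>?j\<close> modulo \<open>n\<close>, and
      those with \<open>n \<le> k + ?j\<close> wrap around, none if \<open>n = 0\<close>.\<close>
    define m where "m k = a [^] k \<otimes> \<tau> g \<otimes> a [^] (- k) \<otimes> a [^] (k + ?j - (k + ?j) mod n)" for k
    have "m k \<in> ?L" for k
      unfolding m_def using \<tau> g by (intro factor) (auto simp: minus_mod_eq_mult_div)
    moreover have "\<tau> (x \<otimes> g) = \<tau> x \<otimes> m (\<kappa> x)" if x: "x \<in> H" for x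
      unfolding m_def \<tau>_def \<kappa>_mult[OF x g]
      using product[OF H_carrier[OF x] H_carrier[OF g], of "\<kappa> x" ?j "\<kappa> x + ?j - (\<kappa> x + ?j) mod n"] by simp
    ultimately show "\<exists>\<phi> m W. (\<forall>x\<in>H. m (\<kappa> x) \<in> ?L \<and> \<kappa> (x \<otimes> g) = \<phi> (\<kappa> x) \<and> \<tau> (x \<otimes> g) = \<tau> x \<otimes> m (\<kappa> x)) \<and>
      (\<forall>k\<in>\<kappa> ` H. \<forall>l\<in>\<kappa> ` H. k < l \<longrightarrow> (k \<in> W \<longrightarrow> l \<in> W) \<and>
        ((k \<in> W \<longleftrightarrow> l \<in> W) \<longrightarrow> \<phi> k < \<phi> l) \<and> (k \<notin> W \<longrightarrow> l \<in> W \<longrightarrow> \<phi> l < \<phi> k))"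
      using \<kappa>(2) \<kappa>_mult g mod_translation_less[OF n(1)] mod_translation_wrap
      by (intro exI[of _ "\<lambda>k. (k + ?j) mod n"] exI[of _ m] exI[of _ "{k. 0 < n \<and> n \<le> k + ?j}"]) auto
  qed
  have "linear_order_on H ?r"
    using linear_order_on_lexicographic_order[of r \<tau> H \<kappa>] r \<tau> inj by (auto simp: separable_order_def)
  then have Field: "Field ?r = H"
    by (auto simp: order_on_defs Field_def refl_on_def)
  show ?thesis
  proof (rule that[OF sep], unfold Field)
    \<comment> \<open>\<open>L\<close> is the level 0, and \<open>\<tau>\<close> is the identity
      there, so the new order extends \<open>r\<close>.\<close>
    have L_\<kappa>: "x \<in> H" "\<kappa> x = 0" "\<tau> x = x" if "x \<in> ?L" for x
    proof -
      have x: "x \<in> carrier G" "x \<otimes> a [^] (- (0::int)) \<in> ?L"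
        using that by auto
      then show "x \<in> H" unfolding H_def by blast
      show "\<kappa> x = 0" using \<kappa>_eq[OF x] by simp
      then show "\<tau> x = x" using x unfolding \<tau>_def by simp
    qed
    show "r \<subseteq> ?r"
    proof (rule subrelI)
      fix x y assume "(x, y) \<in> r"
      moreover from this have "x \<in> ?L" "y \<in> ?L"
        by (auto intro: FieldI1 FieldI2)
      ultimately show "(x, y) \<in> ?r"
        by (simp add: lexicographic_order_def L_\<kappa>)
    qed
    show "H \<subseteq> {h \<otimes> a [^] k |h (k::int). h \<in> ?L}"
    proof
      fix x assume "x \<in> H"
      then show "x \<in> {h \<otimes> a [^] k |h (k::int). h \<in> ?L}"
        using \<kappa>(1)[of x] decomp[OF H_carrier, of x "\<kappa> x"] by blast
    qed
    have "a \<otimes> a [^] (- (1::int)) = \<one>"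
      using a by (simp add: int_pow_neg)
    then have "a \<otimes> a [^] (- (1::int)) \<in> ?L"
      using L.one_closed by metis
    then show "a \<in> H"
      using a unfolding H_def by blast
    show "subgroup H G"
    proof (rule subgroupI)
      show "H \<noteq> {}"
        using \<open>a \<in> H\<close> by blast
      fix x assume x: "x \<in> H"
      let ?k = "\<kappa> x"
      \<comment> \<open>The inverse has exponent \<open>- ?k\<close>, and its component is a
        conjugate of the inverse of that of \<open>x\<close>.\<close>
      have "inv x \<otimes> a [^] ?k = a [^] (- ?k) \<otimes> inv (x \<otimes> a [^] (- ?k)) \<otimes> a [^] (- (- ?k))"
        using H_carrier[OF x] a pow by (simp add: inv_mult_group int_pow_neg m_assoc[symmetric])
      also have "\<dots> \<in> ?L"
        using normal \<kappa>(1)[OF x] by blast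
      finally have "inv x \<otimes> a [^] (- (- ?k)) \<in> ?L"
        by simp
      then show "inv x \<in> H"
        using H_carrier[OF x] unfolding H_def by blast
      show "x \<otimes> y \<in> H" if "y \<in> H" for y
        using closed[OF x that] .
    next
      show "H \<subseteq> carrier G"
        using H_carrier by blast
    qed
  qed
qed

text \<open>A finite set \<open>S\<close> together with the translating element \<open>g\<close>
  lies in the field of one member of the chain, and the decomposition found there persists by
  monotonicity.\<close>

lemma separable_order_Union:
  assumes "C \<noteq> {}" "subset.chain \<A> C"
    and \<A>: "\<And>r. r \<in> \<A> \<Longrightarrow> separable_order G r \<and> subgroup (Field r) G"
  shows "separable_order G (\<Union>C)" "subgroup (Field (\<Union>C)) G"
proof -
  have C: "separable_order G r" "subgroup (Field r) G" if "r \<in> C" for r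
    using assms(2) \<A> that unfolding subset_chain_def by blast+
  have "\<forall>X\<in>C. \<forall>Y\<in>C. X \<subseteq> Y \<or> Y \<subseteq> X"
    using assms(2) unfolding subset_chain_def by blast
  then have chain: "chain\<^sub>\<subseteq> C" "subset.chain UNIV (Field ` C)"
    by (auto simp: chain_subset_def subset_chain_def dest: mono_Field)
  have common: "\<exists>r\<in>C. S \<subseteq> Field r" if "finite S" "S \<subseteq> Field (\<Union>C)" for S
    using finite_subset_Union_chain[OF that(1) _ _ chain(2)] that(2) assms(1) by auto
  have order: "refl_on (Field r) r" "trans r" "antisym r" "total_on (Field r) r" if "r \<in> C" for r
    using C(1)[OF that] by (auto simp: separable_order_def order_on_defs)
  have "refl_on (Field (\<Union>C)) (\<Union>C)"
    using order(1) by (auto simp: refl_on_def)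
  moreover have "trans (\<Union>C)" "antisym (\<Union>C)" "total_on (Field (\<Union>C)) (\<Union>C)"
    using chain_subset_trans_Union chain_subset_antisym_Union chain_subset_Total_Union chain(1) order by blast+
  ultimately have "Linear_order (\<Union>C)"
    unfolding order_on_defs by (auto intro: FieldI1 FieldI2 simp del: Field_Union)
  moreover have "decomposes (\<Union>C) (\<lambda>x. x \<otimes> g) S"
    if g: "g \<in> Field (\<Union>C)" and S: "S \<subseteq> Field (\<Union>C)" "finite S" "\<exists>x\<in>S. \<exists>y\<in>S. x \<noteq> y" for g S
  proof -
    obtain r where r: "r \<in> C" "insert g S \<subseteq> Field r"
      using common[of "insert g S"] g S by blast
    then have "decomposes r (\<lambda>x. x \<otimes> g) S"
      using C(1)[OF r(1)] S unfolding separable_order_def by blast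
    then show ?thesis
      using r(1) by (blast intro: decomposes_mono)
  qed
  ultimately show "separable_order G (\<Union>C)"
    unfolding separable_order_def by blast
  show "subgroup (Field (\<Union>C)) G"
  proof (rule subgroupI)
    show "Field (\<Union>C) \<subseteq> carrier G"
      using C(2) subgroup.subset by fastforce
    show "Field (\<Union>C) \<noteq> {}"
      using C(2) assms(1) subgroup.one_closed by fastforce
    show "inv x \<in> Field (\<Union>C)" if "x \<in> Field (\<Union>C)" for x
      using C(2) that by (auto dest: subgroup.m_inv_closed)
    show "x \<otimes> y \<in> Field (\<Union>C)" if xy: "x \<in> Field (\<Union>C)" "y \<in> Field (\<Union>C)" for x y
    proof -
      obtain r where "r \<in> C" "{x, y} \<subseteq> Field r"
        using common[of "{x, y}"] xy by blast
      then have "x \<otimes> y \<in> Field r"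
        using C(2) subgroup.m_closed by fastforce
      then show ?thesis
        using \<open>r \<in> C\<close> by auto
    qed
  qed
qed

text \<open>A subgroup between \<open>Field r\<close> and \<open>H\<close> contains all commutators
  of \<open>H\<close>, so it is normalized by \<open>H\<close>. The cyclic extension by an element
  of \<open>H\<close> therefore applies to a maximal such ordered subgroup, which must be all of
  \<open>H\<close>.\<close>

lemma separable_order_abelian_extension:
  assumes r: "separable_order G r" and K: "subgroup (Field r) G"
    and H: "subgroup H G" "Field r \<subseteq> H" "derived G H \<subseteq> Field r"
  obtains r' where "separable_order G r'" "Field r' = H"
proof -
  define \<A> where "\<A> = {q. separable_order G q \<and> subgroup (Field q) G \<and> Field r \<subseteq> Field q \<and> Field q \<subseteq> H}"
  interpret H: subgroup H G by (rule H(1))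
  have "\<exists>q\<in>\<A>. \<forall>q'\<in>\<A>. q \<subseteq> q' \<longrightarrow> q' = q"
  proof (rule subset_Zorn_nonempty)
    show "\<A> \<noteq> {}"
      using assms unfolding \<A>_def by blast
    fix C assume C: "C \<noteq> {}" "subset.chain \<A> C"
    then have "C \<subseteq> \<A>"
      by (auto simp: subset_chain_def)
    then have "Field r \<subseteq> Field (\<Union>C)" "Field (\<Union>C) \<subseteq> H"
      using C(1) unfolding \<A>_def by auto
    moreover have "separable_order G (\<Union>C)" "subgroup (Field (\<Union>C)) G"
      using separable_order_Union[OF C] unfolding \<A>_def by blast+
    ultimately show "\<Union>C \<in> \<A>"
      unfolding \<A>_def by blast
  qed
  then obtain q where q: "q \<in> \<A>" and maximal: "\<And>q'. q' \<in> \<A> \<Longrightarrow> q \<subseteq> q' \<Longrightarrow> q' = q"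
    by blast
  then have L: "separable_order G q" "subgroup (Field q) G" "Field r \<subseteq> Field q" "Field q \<subseteq> H"
    unfolding \<A>_def by blast+
  interpret L: subgroup "Field q" G by (rule L(2))
  have normal: "x \<otimes> h \<otimes> inv x \<in> Field q" if "x \<in> H" "h \<in> Field q" for x h
  proof -
    have "x \<otimes> h \<otimes> inv x \<otimes> inv h \<in> derived G H"
      unfolding derived_def using that L(4) by (intro generate.incl) blast
    then have "x \<otimes> h \<otimes> inv x \<otimes> inv h \<otimes> h \<in> Field q"
      using H(3) L(3) that(2) by (blast intro: L.m_closed[of "x \<otimes> h \<otimes> inv x \<otimes> inv h" h])
    moreover have "x \<otimes> h \<otimes> inv x \<otimes> inv h \<otimes> h = x \<otimes> h \<otimes> inv x"
      using that L.subset H.subset by (auto simp: m_assoc)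
    ultimately show ?thesis
      by simp
  qed
  have "a \<in> Field q" if a: "a \<in> H" for a
  proof -
    have pow: "a [^] (k::int) \<in> H" for k
      by (rule subgroup_int_pow_closed[OF H(1) a])
    have "a [^] k \<otimes> h \<otimes> a [^] (- k) \<in> Field q" if "h \<in> Field q" for h and k :: int
      using normal[OF pow that] a by (simp add: int_pow_neg)
    then obtain q' where q': "separable_order G q'" "q \<subseteq> q'" "subgroup (Field q') G" "a \<in> Field q'"
      "Field q' \<subseteq> {h \<otimes> a [^] k |h (k::int). h \<in> Field q}"
      by (rule separable_order_cyclic_extension[OF L(1,2) H.mem_carrier[OF a]])
    have "Field q' \<subseteq> H"
      using q'(5) L(4) pow H.m_closed by blast
    then have "q' \<in> \<A>"
      using q' L(3) mono_Field unfolding \<A>_def by blast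
    then show ?thesis
      using maximal q'(2,4) by blast
  qed
  then show ?thesis
    using that L(1,4) by blast
qed

text \<open>The series is climbed from the trivial subgroup. That the quotient of \<open>H\<close>
  by \<open>K\<close> is abelian is used in the form
  \<open>derived G H \<subseteq> K\<close>.\<close>

lemma solvable_seq_separable_order:
  assumes "solvable_seq G H"
  shows "\<exists>r. separable_order G r \<and> Field r = H"
  using assms
proof induction
  case unity
  have "separable_order G {(\<one>, \<one>)}" "Field {(\<one>, \<one>)} = {\<one>}"
    by (auto simp: separable_order_def)
  then show ?case by blast
next
  case (extension K H)
  then obtain r where r: "separable_order G r" "Field r = K"
    by blast
  have "subgroup K G" "derived G H \<subseteq> K" "K \<subseteq> H"
    using extension solvable_imp_subgroup derived_of_subgroup_minimal normal_imp_subgroup[OF extension(2)]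
      subgroup.subset by fastforce+
  then show ?case
    using separable_order_abelian_extension[OF r(1), of H] r(2) extension(3) by metis
qed

end

section \<open>From separable orders to strict twin-width\<close>

context group
begin

text \<open>A one of the matrix is determined by its row, so a decomposition of the set of rows of
  \<open>T'\<close> under right multiplication by \<open>g\<close> splits \<open>T'\<close> as
  \<open>separable_adjacent_pair\<close> requires.\<close>

lemma separable_order_stww_finite_le_2:
  assumes r: "separable_order G r" "Field r = carrier G" and g: "g \<in> carrier G"
    and X: "X \<subseteq> carrier G" "finite X" "X \<noteq> {}" and Y: "Y \<subseteq> carrier G" "finite Y" "Y \<noteq> {}"
  shows "stww_finite r X r Y (translation_matrix G g) \<le> 2"
proof -
  have "linear_order_on (carrier G) r"
    using r by (simp add: separable_order_def)
  then obtain u v :: "'a \<Rightarrow> nat" where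
    u: "inj_on u X" "\<And>x y. x \<in> X \<Longrightarrow> y \<in> X \<Longrightarrow> (x, y) \<in> r \<longleftrightarrow> u x \<le> u y" and
    v: "inj_on v Y" "\<And>x y. x \<in> Y \<Longrightarrow> y \<in> Y \<Longrightarrow> (x, y) \<in> r \<longleftrightarrow> v x \<le> v y"
    using finite_linear_order_rank X Y by metis
  have u_less: "u x < u y" if "x \<in> X" "y \<in> X" "x \<noteq> y" "(x, y) \<in> r" for x y
    using u that by (metis inj_onD nat_less_le)
  have v_less: "v x < v y" if "x \<in> Y" "y \<in> Y" "x \<noteq> y" "(x, y) \<in> r" for x y
    using v that by (metis inj_onD nat_less_le)
  interpret separable_matrix r X u r Y v "translation_matrix G g"
  proof
    fix T assume T: "T \<subseteq> {(x, y) \<in> X \<times> Y. translation_matrix G g x y}" "\<exists>p\<in>T. \<exists>q\<in>T. p \<noteq> q"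
    have entry: "fst t \<in> X" "snd t \<in> Y" "fst t \<otimes> g = snd t" if "t \<in> T" for t
      using T(1) that by (auto simp: translation_matrix_def)
    have "finite T"
      by (rule finite_subset[OF T(1)], rule finite_subset[of _ "X \<times> Y"]) (use X(2) Y(2) in auto)
    moreover have "\<exists>A B. A \<noteq> {} \<and> B \<noteq> {} \<and> A \<union> B = T' \<and> (\<forall>a\<in>A. \<forall>b\<in>B. u (fst a) < u (fst b)) \<and>
        ((\<forall>a\<in>A. \<forall>b\<in>B. v (snd a) < v (snd b)) \<or> (\<forall>a\<in>A. \<forall>b\<in>B. v (snd b) < v (snd a)))"
      if T': "T' \<subseteq> T" "\<exists>x\<in>T'. \<exists>y\<in>T'. x \<noteq> y" for T'
    proof -
      have entry': "fst t \<in> X" "snd t \<in> Y" "fst t \<otimes> g = snd t" if "t \<in> T'" for t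
        using entry T'(1) that by blast+
      have "finite (fst ` T')"
        using \<open>finite T\<close> T'(1) by (meson finite_imageI finite_subset)
      moreover have "fst ` T' \<subseteq> Field r"
        using entry'(1) X(1) r(2) by blast
      moreover have "\<exists>x\<in>fst ` T'. \<exists>y\<in>fst ` T'. x \<noteq> y"
        using T'(2) entry'(3) by (metis imageI prod_eqI)
      ultimately have "decomposes r (\<lambda>x. x \<otimes> g) (fst ` T')"
        using r g unfolding separable_order_def by blast
      then obtain A B where AB: "A \<noteq> {}" "B \<noteq> {}" "A \<union> B = fst ` T'"
        "\<And>a b. a \<in> A \<Longrightarrow> b \<in> B \<Longrightarrow> a \<noteq> b \<and> (a, b) \<in> r"
        "(\<forall>a\<in>A. \<forall>b\<in>B. (a \<otimes> g, b \<otimes> g) \<in> r) \<or> (\<forall>a\<in>A. \<forall>b\<in>B. (b \<otimes> g, a \<otimes> g) \<in> r)"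
        unfolding decomposes_def by metis
      let ?A = "{t \<in> T'. fst t \<in> A}" and ?B = "{t \<in> T'. fst t \<in> B}"
      have "A \<subseteq> fst ` T'" "B \<subseteq> fst ` T'" "fst ` T' \<subseteq> A \<union> B"
        using AB(3) by auto
      then have "?A \<noteq> {}" "?B \<noteq> {}" "?A \<union> ?B = T'"
        using AB(1,2) by fast+
      moreover have "\<forall>a\<in>?A. \<forall>b\<in>?B. u (fst a) < u (fst b)"
        using AB(4) u_less entry'(1) by simp
      \<comment> \<open>Cancelling \<open>g\<close> makes the columns distinct, which turns the
        reflexive comparison into a strict one.\<close>
      moreover have ne: "snd a \<noteq> snd b" if "a \<in> ?A" "b \<in> ?B" for a b
      proof
        assume "snd a = snd b"
        then have "fst a \<otimes> g = fst b \<otimes> g"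
          using entry'(3) that by simp
        then have "fst a = fst b"
          using entry'(1) that X(1) g by (simp add: subset_iff)
        then show False
          using AB(4)[of "fst a" "fst b"] that by simp
      qed
      have "(\<forall>a\<in>?A. \<forall>b\<in>?B. (snd a, snd b) \<in> r) \<or> (\<forall>a\<in>?A. \<forall>b\<in>?B. (snd b, snd a) \<in> r)"
        using AB(5) entry'(3) by (metis (mono_tags, lifting) mem_Collect_eq)
      then have "(\<forall>a\<in>?A. \<forall>b\<in>?B. v (snd a) < v (snd b)) \<or> (\<forall>a\<in>?A. \<forall>b\<in>?B. v (snd b) < v (snd a))"
        using ne v_less entry'(2) by (metis (mono_tags, lifting) mem_Collect_eq)
      ultimately show ?thesis
        by (intro exI[of _ ?A] exI[of _ ?B] conjI)
    qed
    ultimately show "\<exists>p\<in>T. \<exists>q\<in>T. p \<noteq> q \<and> (\<forall>t\<in>T. between (u (fst p)) (u (fst t)) (u (fst q)) \<or>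
        between (v (snd p)) (v (snd t)) (v (snd q)) \<longrightarrow> t = p \<or> t = q)"
      using T(2) by (rule separable_adjacent_pair)
  next
    show "x = x'" if "x \<in> X" "x' \<in> X" "translation_matrix G g x y" "translation_matrix G g x' y" for x x' y
      using that X(1) g unfolding translation_matrix_def by (metis right_cancel subsetD)
  qed (use X Y u v in \<open>auto simp: translation_matrix_def\<close>)
  show ?thesis
    by (rule stww_finite_le_2)
qed

lemma separable_order_stww_le_2:
  assumes "separable_order G r" "Field r = carrier G" "g \<in> carrier G"
  shows "stww r (carrier G) r (carrier G) (translation_matrix G g) \<le> 2"
  unfolding stww_def
  using separable_order_stww_finite_le_2[OF assms] carrier_not_empty by (auto intro!: SUP_least)

end

section \<open>The lower bound\<close>

lemma max_ones_ge_row: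
  assumes "finite P" "finite Q" "A \<in> P" "B \<in> Q" "B' \<in> Q" "B \<noteq> B'" "N A B" "N A B'"
  shows "2 \<le> max_ones N P Q"
proof -
  have "card {B, B'} \<le> card {B \<in> Q. N A B}"
    by (rule card_mono) (use assms in auto)
  also have "\<dots> \<le> max_ones N P Q"
    unfolding max_ones_def by (rule Max_ge) (use assms in auto)
  finally show ?thesis
    using assms(6) by simp
qed

lemma max_ones_ge_column:
  assumes "finite P" "finite Q" "A \<in> P" "A' \<in> P" "B \<in> Q" "A \<noteq> A'" "N A B" "N A' B"
  shows "2 \<le> max_ones N P Q"
proof -
  have "card {A, A'} \<le> card {A \<in> P. N A B}"
    by (rule card_mono) (use assms in auto)
  also have "\<dots> \<le> max_ones N P Q"
    unfolding max_ones_def by (rule Max_ge) (use assms in auto)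
  finally show ?thesis
    using assms(6) by simp
qed

text \<open>Already the first merge creates a row or column with two ones.\<close>

lemma two_le_stww_finite:
  assumes fin: "finite X" "finite Y" and f: "bij_betw f X Y" and x: "x \<in> X" "x' \<in> X" "x \<noteq> x'"
    and M: "\<And>x. x \<in> X \<Longrightarrow> M x (f x)"
  shows "2 \<le> stww_finite r X s Y M"
  unfolding stww_finite_def
proof (rule INF_greatest)
  fix Ds assume "Ds \<in> {Ds. division_sequence r X s Y Ds}"
  then have Ds: "Ds \<noteq> []" "hd Ds = (singletons X, singletons Y)" "last Ds = ({X}, {Y})"
    "\<And>i. Suc i < length Ds \<Longrightarrow>
        merges (fst (Ds ! i)) (fst (Ds ! Suc i)) \<and> snd (Ds ! Suc i) = snd (Ds ! i) \<or>
        fst (Ds ! Suc i) = fst (Ds ! i) \<and> merges (snd (Ds ! i)) (snd (Ds ! Suc i))"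
    unfolding division_sequence_def by auto
  \<comment> \<open>Two distinct rows ensure that the sequence does not end where it starts, so
    there is a first merge.\<close>
  have "singletons X \<noteq> {X}"
    using x unfolding singletons_def by (metis image_eqI insertE singletonD empty_iff)
  then have "hd Ds \<noteq> last Ds"
    using Ds(2,3) by simp
  then have len: "Suc 0 < length Ds"
    using Ds(1) by (cases Ds) (auto split: if_splits)
  obtain P Q where PQ: "Ds ! Suc 0 = (P, Q)"
    by fastforce
  have fin': "finite (singletons X)" "finite (singletons Y)"
    using fin by (auto simp: singletons_def)
  have fX: "f x \<in> Y" if "x \<in> X" for x
    using f that by (auto dest: bij_betwE)
  have f_inj: "f x \<noteq> f y" if "x \<in> X" "y \<in> X" "x \<noteq> y" for x y
    using f that by (auto simp: bij_betw_def dest: inj_onD)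
  have "Ds ! 0 = (singletons X, singletons Y)"
    using Ds(1,2) by (simp add: hd_conv_nth)
  then have "merges (singletons X) P \<and> Q = singletons Y \<or> P = singletons X \<and> merges (singletons Y) Q"
    using Ds(4)[OF len] PQ by simp
  then have "2 \<le> max_ones (quotient_matrix M) P Q"
  proof (elim disjE conjE)
    assume "merges (singletons X) P" "Q = singletons Y"
    then obtain a b where ab: "a \<in> X" "b \<in> X" "a \<noteq> b" "P = insert ({a} \<union> {b}) (singletons X - {{a}, {b}})"
      unfolding merges_def singletons_def by auto
    show ?thesis
      unfolding ab(4) \<open>Q = singletons Y\<close>
      by (rule max_ones_ge_row[of _ _ "{a} \<union> {b}" "{f a}" "{f b}"])
        (use ab fin' fX f_inj M in \<open>auto simp: quotient_matrix_def singletons_def\<close>)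
  next
    assume "merges (singletons Y) Q" "P = singletons X"
    then obtain c d where cd: "c \<in> Y" "d \<in> Y" "c \<noteq> d" "Q = insert ({c} \<union> {d}) (singletons Y - {{c}, {d}})"
      unfolding merges_def singletons_def by auto
    obtain a b where ab: "a \<in> X" "b \<in> X" "c = f a" "d = f b"
      using f cd(1,2) by (auto simp: bij_betw_def)
    show ?thesis
      unfolding cd(4) \<open>P = singletons X\<close>
      by (rule max_ones_ge_column[of _ _ "{a}" "{b}" "{c} \<union> {d}"])
        (use ab cd fin' M in \<open>auto simp: quotient_matrix_def singletons_def\<close>)
  qed
  also have "\<dots> \<le> sequence_width M Ds"
    unfolding sequence_width_def
    using nth_mem[OF len] PQ by (intro Max_ge) force+
  finally show "2 \<le> enat (sequence_width M Ds)"
    by (simp add: numeral_eq_enat)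
qed

text \<open>Translation by the identity gives the diagonal matrix, whatever the order. If the group
  is infinite, the submatrix on \<open>\<one>\<close> and one further element suffices.\<close>

lemma (in group) two_le_stww_translation_one:
  assumes "\<not> trivial_group G"
  shows "2 \<le> stww r (carrier G) r (carrier G) (translation_matrix G \<one>)"
proof -
  obtain x where x: "x \<in> carrier G" "x \<noteq> \<one>"
    using assms group_axioms unfolding trivial_group_def by blast
  have "2 \<le> stww_finite r X r X (translation_matrix G \<one>)" if "finite X" "X \<subseteq> carrier G" "{x, \<one>} \<subseteq> X" for X
    by (rule two_le_stww_finite[where f = id and x = x and x' = \<one>])
      (use that x in \<open>auto simp: translation_matrix_def\<close>)
  from this[of "carrier G"] this[of "{x, \<one>}"] show ?thesis
    unfolding stww_def using x by (auto intro!: SUP_upper2[of "({x, \<one>}, {x, \<one>})"])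
qed

theorem proposition6p10:
  fixes G :: "('a, 'b) monoid_scheme"
  assumes "group G"
    and "solvable G"
    and "\<not> trivial_group G"
  shows "utww G = 2"
proof (rule antisym)
  interpret group G by (rule assms(1))
  obtain r where r: "separable_order G r" "Field r = carrier G"
    using solvable_seq_separable_order assms(2) unfolding solvable_def by blast
  then have "linear_order_on (carrier G) r"
    by (simp add: separable_order_def)
  then show "utww G \<le> 2"
    unfolding utww_def using separable_order_stww_le_2[OF r]
    by (intro INF_lower2[of r]) (auto intro!: SUP_least)
  show "2 \<le> utww G"
    unfolding utww_def using two_le_stww_translation_one[OF assms(3)]
    by (intro INF_greatest SUP_upper2[of "\<one>\<^bsub>G\<^esub>"]) auto
qed

end
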